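(* For every integer $n\ge 3$, we have $C(n)\le (2n-5)\,C_{\mathrm{x}}(n)$.
   Context: All point sets are finite subsets of $\mathbb{R}^2$ with no three points collinear. A plane straight-line graph is a graph whose vertices are points in the plane and whose edges are straight-line segments between vertices, no two of which cross. A convex polygon in a plane straight-line graph $G$ is a cycle of $G$ (as a subgraph) whose interior (the bounded region it encloses) is convex. $C(G)$ denotes the number of convex polygons in $G$. For $n\ge 3$, $C(n)$ is the maximum of $C(G)$ over all plane straight-line graphs $G$ on $n$ points in the plane, and $C_{\mathrm{x}}(n)$ is the maximum of $C(G)$ over all plane straight-line graphs $G$ on $n$ points in convex position. *)

theory Defs
  imports "HOL-Analysis.Analysis"
begin

definition general_position :: "(real^2) set \<Rightarrow> bool" where
  "general_position V \<longleftrightarrow> finite V \<and> (\<forall>S\<subseteq>V. card S = 3 \<longrightarrow> \<not> collinear S)"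

definition convex_position :: "(real^2) set \<Rightarrow> bool" where
  "convex_position V \<longleftrightarrow> (\<forall>p\<in>V. p \<notin> convex hull (V - {p}))"

text \<open>
  The edge \<open>{a, b}\<close> is drawn as the segment between \<open>a\<close> and \<open>b\<close>. Two edges cross if their
  relative interiors meet; an edge cannot pass through a third vertex because the vertices
  are in general position.
\<close>

definition plane_straight_line_graph :: "(real^2) set \<Rightarrow> (real^2) set set \<Rightarrow> bool" where
  "plane_straight_line_graph V E \<longleftrightarrow>
     general_position V \<and>
     (\<forall>e\<in>E. e \<subseteq> V \<and> card e = 2) \<and>
     (\<forall>a b c d. {a, b} \<in> E \<longrightarrow> {c, d} \<in> E \<longrightarrow> {a, b} \<noteq> {c, d} \<longrightarrow>
        open_segment a b \<inter> open_segment c d = {})"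

definition cyclic_edges :: "'a list \<Rightarrow> 'a set set" where
  "cyclic_edges vs = (\<lambda>i. {vs ! i, vs ! (Suc i mod length vs)}) ` {..<length vs}"

text \<open>
  A cycle is a subgraph without isolated vertices, so it is identified with its edge set; the
  starting point and the direction of traversal are irrelevant.
\<close>

definition is_cycle :: "'a set set \<Rightarrow> 'a set set \<Rightarrow> bool" where
  "is_cycle E F \<longleftrightarrow>
     F \<subseteq> E \<and> (\<exists>vs. distinct vs \<and> 3 \<le> length vs \<and> F = cyclic_edges vs)"

definition drawing :: "(real^2) set set \<Rightarrow> (real^2) set" where
  "drawing F = (\<Union>e\<in>F. convex hull e)"

text \<open>
  For a closed curve, \<^const>\<open>inside\<close> is the union of the bounded components of the
  complement. Other vertices and edges of the graph may lie in this region.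
\<close>

definition is_convex_polygon :: "(real^2) set set \<Rightarrow> (real^2) set set \<Rightarrow> bool" where
  "is_convex_polygon E F \<longleftrightarrow> is_cycle E F \<and> convex (inside (drawing F))"

definition num_convex_polygons :: "(real^2) set set \<Rightarrow> nat" where
  "num_convex_polygons E = card {F. is_convex_polygon E F}"

definition max_convex_polygons :: "nat \<Rightarrow> nat" where
  "max_convex_polygons n =
     Max {num_convex_polygons E | V E. plane_straight_line_graph V E \<and> card V = n}"

definition max_convex_polygons_convex_position :: "nat \<Rightarrow> nat" where
  "max_convex_polygons_convex_position n =
     Max {num_convex_polygons E | V E.
            plane_straight_line_graph V E \<and> convex_position V \<and> card V = n}"

text \<open>Both maxima range over finite nonempty sets of values.\<close>

lemma num_convex_polygons_le:
  assumes "plane_straight_line_graph V E" "card V = n"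
  shows "num_convex_polygons E \<le> 2 ^ 2 ^ n"
proof -
  have fV: "finite V" and EV: "E \<subseteq> Pow V"
    using assms by (auto simp: plane_straight_line_graph_def general_position_def)
  have "{F. is_convex_polygon E F} \<subseteq> Pow (Pow V)"
    using EV by (auto simp: is_convex_polygon_def is_cycle_def)
  then have "num_convex_polygons E \<le> card (Pow (Pow V))"
    unfolding num_convex_polygons_def using fV by (intro card_mono) auto
  then show ?thesis
    using fV assms(2) by (simp add: card_Pow)
qed

lemma finite_num_convex_polygons:
  "finite {num_convex_polygons E | V E. plane_straight_line_graph V E \<and> card V = n}"
  by (rule finite_subset[of _ "{..2 ^ 2 ^ n}"]) (auto intro: num_convex_polygons_le)

lemma finite_num_convex_polygons_convex_position:
  "finite {num_convex_polygons E | V E.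
     plane_straight_line_graph V E \<and> convex_position V \<and> card V = n}"
  by (rule finite_subset[OF _ finite_num_convex_polygons[of n]]) blast

lemma convex_position_graph_exists:
  "\<exists>V E. plane_straight_line_graph V E \<and> convex_position V \<and> card V = n"
proof -
  define p :: "nat \<Rightarrow> real^2" where "p i = vector [real i, real i ^ 2]" for i
  define V where "V = p ` {..<n}"
  define h :: "nat \<Rightarrow> real^2" where "h i = vector [- 2 * real i, 1]" for i
  have h: "h i \<bullet> p j = (real j - real i)\<^sup>2 - (real i)\<^sup>2" for i j
    unfolding h_def p_def
    by (simp add: inner_vec_def sum_2 power2_eq_square algebra_simps)
  have inj: "inj p"
    by (rule injI) (auto simp: p_def vec_eq_iff forall_2)
  have cp: "p i \<notin> convex hull (p ` (A - {i}))" for i A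
  proof
    assume "p i \<in> convex hull (p ` (A - {i}))"
    moreover have "convex hull (p ` (A - {i})) \<subseteq> {x. h i \<bullet> x > - (real i)\<^sup>2}"
      by (rule hull_minimal) (auto simp: h convex_halfspace_gt)
    ultimately show False using h[of i i] by auto
  qed
  have conv: "convex_position V"
    unfolding convex_position_def
  proof
    fix x assume "x \<in> V"
    then obtain i where i: "x = p i" by (auto simp: V_def)
    have "V - {x} = p ` ({..<n} - {i})"
      using inj by (auto simp: V_def i inj_on_def)
    with cp i show "x \<notin> convex hull (V - {x})" by simp
  qed
  have "\<not> collinear S" if S: "S \<subseteq> V" "card S = 3" for S
  proof
    assume col: "collinear S"
    obtain a b c where abc: "S = {a, b, c}" "a \<noteq> b" "b \<noteq> c" "a \<noteq> c"
      using S(2) by (auto simp: card_3_iff)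
    have notin: "x \<notin> convex hull T" if "x \<in> V" "T \<subseteq> V - {x}" for x T
      using conv that hull_mono[of T "V - {x}" convex] by (auto simp: convex_position_def)
    have "\<not> between (b, c) a" "\<not> between (c, a) b" "\<not> between (a, b) c"
      using notin[of a "{b, c}"] notin[of b "{c, a}"] notin[of c "{a, b}"] S(1) abc
      by (auto simp: between_mem_convex_hull)
    with col show False
      by (simp add: abc(1) collinear_between_cases)
  qed
  then have "plane_straight_line_graph V {}"
    by (auto simp: plane_straight_line_graph_def general_position_def V_def)
  moreover have "card V = n"
    using inj by (simp add: V_def card_image inj_on_subset)
  ultimately show ?thesis using conv by blast
qed

end

theory Submission
  imports Defs
begin

text \<open>
  Fix a point \<open>o\<close> lying on no line through two vertices, and consider the convex polygons of the graph
  that contain \<open>o\<close> in their interior. Replace such a polygon \<open>K\<close> by the set \<open>V \<inter> K\<close>, which determines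
  \<open>K\<close>, and join consecutive elements of this set in the angular order around \<open>o\<close>. After projecting \<open>V\<close>
  radially onto a circle around \<open>o\<close>, the chords obtained from all these polygons together do not
  cross: a crossing would give \<open>c \<in> L - K\<close> in the sector of an edge of \<open>K\<close> and \<open>b \<in> K - L\<close> in the
  sector of an edge of \<open>L\<close>; between the directions of \<open>b\<close> and \<open>c\<close> the two boundaries meet, which in a
  plane graph forces a common vertex of \<open>K\<close> and \<open>L\<close> inside a sector that should be empty. So at most
  \<open>C\<^sub>x(n)\<close> convex polygons contain \<open>o\<close>.

  It remains to pierce all convex polygons by \<open>2n - 5\<close> points. Sort the vertices along a generic
  direction. A polygon contains, for a vertex \<open>b\<close> of it that is neither first nor last, the points
  just above \<open>b\<close> or the points just below \<open>b\<close>. Of these \<open>2(n - 2)\<close> possibilities one never occurs,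
  namely the outer side of a vertex farthest from the line through the first and the last vertex.
\<close>

section \<open>Cycles as simple closed curves\<close>

lemma plane_vertex_notin_open_segment:
  assumes G: "plane_straight_line_graph V E" and e: "{a, b} \<in> E" and v: "v \<in> V"
  shows "v \<notin> open_segment a b"
proof
  assume v': "v \<in> open_segment a b"
  from G e have ab: "a \<in> V" "b \<in> V" "a \<noteq> b"
    by (auto simp: plane_straight_line_graph_def)
  from v' have ne: "v \<noteq> a" "v \<noteq> b"
    by (auto simp: open_segment_def)
  have "collinear {a, v, b}"
    using v' by (simp add: collinear_between_cases between_mem_segment open_segment_def
        closed_segment_commute)
  moreover have "{a, v, b} \<subseteq> V" "card {a, v, b} = 3"
    using v ab ne by auto
  ultimately show False
    using G unfolding plane_straight_line_graph_def general_position_def by blast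
qed

lemma plane_open_segments_eq:
  assumes "plane_straight_line_graph V E" "{a, b} \<in> E" "{c, d} \<in> E"
    and "x \<in> open_segment a b" "x \<in> open_segment c d"
  shows "{a, b} = {c, d}"
proof (rule ccontr)
  assume "{a, b} \<noteq> {c, d}"
  then have "open_segment a b \<inter> open_segment c d = {}"
    using assms(1-3) unfolding plane_straight_line_graph_def by blast
  then show False using assms(4,5) by blast
qed

text \<open>Open edges are disjoint and contain no vertex, so a common point must be an end of both
  edges.\<close>

lemma plane_closed_segment_Int:
  assumes G: "plane_straight_line_graph V E" and e: "{a, b} \<in> E" "{c, d} \<in> E" "{a, b} \<noteq> {c, d}"
  shows "closed_segment a b \<inter> closed_segment c d \<subseteq> {a, b} \<inter> {c, d}"
proof
  fix x assume x: "x \<in> closed_segment a b \<inter> closed_segment c d"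
  have V: "a \<in> V" "b \<in> V" "c \<in> V" "d \<in> V"
    using G e by (auto simp: plane_straight_line_graph_def)
  have no: "open_segment a b \<inter> open_segment c d = {}"
    using G e by (auto simp: plane_straight_line_graph_def)
  show "x \<in> {a, b} \<inter> {c, d}"
    using x no V plane_vertex_notin_open_segment[OF G e(1)] plane_vertex_notin_open_segment[OF G e(2)]
    unfolding open_segment_def by auto
qed

text \<open>The open path, without the edge back to the start. The last equation covers the
  singleton list, where the path is constant, and the empty list, where its value is
  arbitrary.\<close>

fun polygonal_path :: "'a::real_normed_vector list \<Rightarrow> real \<Rightarrow> 'a" where
  "polygonal_path (a # b # c # xs) = linepath a b +++ polygonal_path (b # c # xs)"
| "polygonal_path [a, b] = linepath a b"
| "polygonal_path xs = linepath (hd xs) (hd xs)"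

lemma pathstart_polygonal_path [simp]: "vs \<noteq> [] \<Longrightarrow> pathstart (polygonal_path vs) = hd vs"
  by (induction vs rule: polygonal_path.induct) auto

lemma pathfinish_polygonal_path [simp]: "vs \<noteq> [] \<Longrightarrow> pathfinish (polygonal_path vs) = last vs"
  by (induction vs rule: polygonal_path.induct) auto

lemma path_image_polygonal_path:
  "2 \<le> length vs \<Longrightarrow>
    path_image (polygonal_path vs) = (\<Union>i<length vs - 1. closed_segment (vs ! i) (vs ! Suc i))"
proof (induction vs rule: polygonal_path.induct)
  case (1 a b c xs)
  have "path_image (polygonal_path (a # b # c # xs)) =
      closed_segment a b \<union> path_image (polygonal_path (b # c # xs))"
    by (simp add: path_image_join)
  also have "\<dots> = (\<Union>i<Suc (length (b # c # xs) - 1).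
      closed_segment ((a # b # c # xs) ! i) ((a # b # c # xs) ! Suc i))"
    unfolding lessThan_Suc_eq_insert_0 using 1 by simp
  finally show ?case by simp
qed (auto simp: lessThan_Suc)

text \<open>Induction on the list: since the vertices are distinct, \<open>a\<close> is not an end
  of any later edge, so the first segment meets the remaining path only in \<open>b\<close>.\<close>

lemma arc_polygonal_path:
  assumes G: "plane_straight_line_graph V E"
  shows "2 \<le> length vs \<Longrightarrow> distinct vs \<Longrightarrow> (\<And>i. i < length vs - 1 \<Longrightarrow> {vs ! i, vs ! Suc i} \<in> E) \<Longrightarrow>
    arc (polygonal_path vs)"
proof (induction vs rule: polygonal_path.induct)
  case (1 a b c xs)
  let ?r = "b # c # xs"
  have e: "{?r ! i, ?r ! Suc i} \<in> E" if "i < length ?r - 1" for i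
    using 1(4)[of "Suc i"] that by auto
  have arc: "arc (polygonal_path ?r)"
    using 1(3) by (intro 1(1) e) auto
  have ab: "{a, b} \<in> E" using 1(4)[of 0] by simp
  have "path_image (linepath a b) \<inter> path_image (polygonal_path ?r) \<subseteq> {b}"
  proof
    fix x assume x: "x \<in> path_image (linepath a b) \<inter> path_image (polygonal_path ?r)"
    then obtain i where i: "i < length ?r - 1" "x \<in> closed_segment (?r ! i) (?r ! Suc i)"
      by (auto simp: path_image_polygonal_path simp del: nth_Cons_Suc polygonal_path.simps)
    have "?r ! i \<in> set ?r" "?r ! Suc i \<in> set ?r"
      using i(1) by (auto simp only: intro!: nth_mem)
    with 1(3) have "a \<notin> {?r ! i, ?r ! Suc i}"
      by auto
    with plane_closed_segment_Int[OF G ab e[OF i(1)]] x i(2) show "x \<in> {b}"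
      by auto
  qed
  then show ?case
    using 1(3) arc by (auto intro!: arc_join)
qed auto

text \<open>The arc through all vertices meets the closing edge only in its two ends, so joining the
  two gives a closed simple path.\<close>

lemma cycle_simple_path:
  assumes G: "plane_straight_line_graph V E" and F: "is_cycle E F"
  obtains g where "simple_path g" "pathfinish g = pathstart g" "path_image g = drawing F"
proof -
  obtain vs where vs: "F \<subseteq> E" "distinct vs" "3 \<le> length vs" "F = cyclic_edges vs"
    using F by (auto simp: is_cycle_def)
  define m where "m = length vs - 1"
  have m: "length vs = Suc m" "2 \<le> m" using vs(3) by (auto simp: m_def)
  have nth: "vs ! i = vs ! j \<longleftrightarrow> i = j" if "i \<le> m" "j \<le> m" for i j
    using vs(2) that m by (simp add: nth_eq_iff_index_eq)
  have e: "{vs ! i, vs ! Suc i} \<in> E" if "i < m" for i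
  proof -
    have "{vs ! i, vs ! (Suc i mod length vs)} \<in> F"
      unfolding vs(4) cyclic_edges_def using that m by (intro imageI) auto
    then show ?thesis using vs(1) that m by auto
  qed
  have ne: "vs \<noteq> []" using m by auto
  have last: "last vs = vs ! m" "hd vs = vs ! 0"
    using ne m by (auto simp: last_conv_nth hd_conv_nth)
  have cl: "{vs ! m, vs ! 0} \<in> E"
  proof -
    have "{vs ! m, vs ! (Suc m mod length vs)} \<in> F"
      unfolding vs(4) cyclic_edges_def using m by (intro imageI) auto
    then show ?thesis using vs(1) m by auto
  qed
  let ?p = "polygonal_path vs" and ?l = "linepath (vs ! m) (vs ! 0)"
  have im: "path_image ?p = (\<Union>i<m. closed_segment (vs ! i) (vs ! Suc i))"
    using m by (simp add: path_image_polygonal_path)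
  have "path_image ?p \<inter> path_image ?l \<subseteq> {vs ! 0, vs ! m}"
  proof
    fix x assume x: "x \<in> path_image ?p \<inter> path_image ?l"
    then obtain i where i: "i < m" "x \<in> closed_segment (vs ! i) (vs ! Suc i)"
      by (auto simp: im)
    \<comment> \<open>Equality would force \<open>i = 0\<close> and \<open>Suc i = m\<close>, which
      contradicts \<open>2 \<le> m\<close>.\<close>
    have "{vs ! i, vs ! Suc i} \<noteq> {vs ! m, vs ! 0}"
      using i m nth[of i m] nth[of "Suc i" m] nth[of i 0] by (auto simp: doubleton_eq_iff)
    from plane_closed_segment_Int[OF G e[OF i(1)] cl this] x i(2) show "x \<in> {vs ! 0, vs ! m}"
      by auto
  qed
  then have "simple_path (?p +++ ?l)"
    using m ne last nth[of 0 m] vs(2) e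
    by (intro simple_path_join_loop arc_polygonal_path[OF G]) auto
  moreover have "pathfinish (?p +++ ?l) = pathstart (?p +++ ?l)"
    using ne last by simp
  moreover have "path_image (?p +++ ?l) = drawing F"
  proof -
    have "path_image (?p +++ ?l) = path_image ?p \<union> path_image ?l"
      using ne last by (simp add: path_image_join)
    also have "\<dots> = (\<Union>i<Suc m. closed_segment (vs ! i) (vs ! (Suc i mod length vs)))"
      unfolding lessThan_Suc using m im by auto
    also have "\<dots> = drawing F"
      unfolding drawing_def vs(4) cyclic_edges_def segment_convex_hull m by simp
    finally show ?thesis .
  qed
  ultimately show ?thesis using that by blast
qed

section \<open>Jordan curve properties of convex polygons\<close>

lemma compact_drawing: "finite F \<Longrightarrow> (\<And>e. e \<in> F \<Longrightarrow> finite e) \<Longrightarrow> compact (drawing F)"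
  unfolding drawing_def by (intro compact_UN) (auto intro: finite_imp_compact_convex_hull)

text \<open>A simple closed curve is a topological circle, so the Jordan-Brouwer theorems apply.
  Convexity makes the inside connected, hence a single component of the complement, whose frontier
  is the whole curve.\<close>

lemma convex_polygon_inside:
  assumes G: "plane_straight_line_graph V E" and F: "is_convex_polygon E F"
  shows "open (inside (drawing F))" "bounded (inside (drawing F))" "convex (inside (drawing F))"
    "inside (drawing F) \<noteq> {}" "frontier (inside (drawing F)) = drawing F"
proof -
  have cyc: "is_cycle E F" and conv: "convex (inside (drawing F))"
    using F by (auto simp: is_convex_polygon_def)
  have "finite F" "\<And>e. e \<in> F \<Longrightarrow> finite e"
    using cyc by (auto simp: is_cycle_def cyclic_edges_def)
  then have comp: "compact (drawing F)" by (rule compact_drawing)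
  obtain g where "simple_path g" "pathfinish g = pathstart g" "path_image g = drawing F"
    using cycle_simple_path[OF G cyc] by blast
  then have "drawing F homeomorphic sphere (0::complex) 1"
    using homeomorphic_simple_path_image_circle[of g 1 0] by simp
  moreover have "sphere (0::complex) 1 homeomorphic sphere (0::real^2) 1"
    by (rule homeomorphic_spheres_gen) auto
  ultimately have hom: "drawing F homeomorphic sphere (0::real^2) 1"
    by (rule homeomorphic_trans)
  show op: "open (inside (drawing F))" "bounded (inside (drawing F))" "convex (inside (drawing F))"
    using comp conv by (auto intro: open_inside bounded_inside compact_imp_closed compact_imp_bounded)
  \<comment> \<open>With an empty inside the complement would equal the outside, which is connected
    in the plane; but a topological circle separates the plane.\<close>
  show ne: "inside (drawing F) \<noteq> {}"
  proof
    assume "inside (drawing F) = {}"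
    then have "outside (drawing F) = - drawing F"
      using inside_Un_outside[of "drawing F"] by simp
    moreover have "connected (outside (drawing F))"
      by (rule connected_outside) (use comp in \<open>auto simp: compact_imp_bounded\<close>)
    ultimately show False using Jordan_Brouwer_separation[OF hom] by simp
  qed
  have "inside (drawing F) \<in> components (- drawing F)"
    using ne conv by (simp add: inside_in_components convex_connected)
  then show "frontier (inside (drawing F)) = drawing F"
    by (rule Jordan_Brouwer_frontier[OF hom]) simp
qed

section \<open>Sectors and chords of the unit circle\<close>

text \<open>The signed area of the parallelogram spanned by \<open>a\<close> and \<open>b\<close>.
  For nonzero vectors it is positive exactly if \<open>b\<close> is reached from \<open>a\<close> by
  a counterclockwise turn strictly between 0 and \<pi>.\<close>

definition det2 :: "real^2 \<Rightarrow> real^2 \<Rightarrow> real" where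
  "det2 a b = a $ 1 * b $ 2 - a $ 2 * b $ 1"

lemma bilinear_det2: "bilinear det2"
  by (auto simp: bilinear_def det2_def algebra_simps intro!: linearI)

lemmas det2_linear_simps [simp] =
  bilinear_ladd[OF bilinear_det2] bilinear_radd[OF bilinear_det2]
  bilinear_lmul[OF bilinear_det2] bilinear_rmul[OF bilinear_det2]
  bilinear_lzero[OF bilinear_det2] bilinear_rzero[OF bilinear_det2]
  bilinear_lneg[OF bilinear_det2] bilinear_rneg[OF bilinear_det2]
  bilinear_lsub[OF bilinear_det2] bilinear_rsub[OF bilinear_det2]

lemma det2_self [simp]: "det2 a a = 0"
  by (simp add: det2_def)

lemma det2_swap: "det2 b a = - det2 a b"
  by (simp add: det2_def)

lemma det2_cramer: "det2 a b *\<^sub>R x = det2 x b *\<^sub>R a + det2 a x *\<^sub>R b"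
  by (simp add: vec_eq_iff forall_2 det2_def algebra_simps)

lemma det2_cramer':
  assumes "det2 a b \<noteq> 0"
  shows "x = (det2 x b / det2 a b) *\<^sub>R a + (det2 a x / det2 a b) *\<^sub>R b"
proof -
  have "det2 a b *\<^sub>R x = det2 a b *\<^sub>R ((det2 x b / det2 a b) *\<^sub>R a + (det2 a x / det2 a b) *\<^sub>R b)"
    using det2_cramer[of a b x] assms by (simp add: scaleR_add_right)
  with assms show ?thesis by (simp del: scaleR_add_right)
qed

lemma linear_det2_right: "linear (det2 a)"
  using bilinear_det2 by (simp add: bilinear_def)

text \<open>The sector conditions \<open>0 < det2 a x\<close>, \<open>0 < det2 x b\<close> describe the open cone spanned
  by \<open>a\<close> and \<open>b\<close> whenever \<open>0 < det2 a b\<close>; the affine form \<open>(det2 x b + det2 a x) / det2 a b\<close> is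
  \<open>1\<close> exactly on the line through \<open>a\<close> and \<open>b\<close>.\<close>

definition chord :: "real^2 \<Rightarrow> real^2 \<Rightarrow> real^2 \<Rightarrow> real" where
  "chord a b x = (det2 x b + det2 a x) / det2 a b"

lemma linear_chord: "linear (chord a b)"
  by (auto simp: chord_def add_divide_distrib distrib_left intro!: linearI)

lemma chord_ends: "det2 a b \<noteq> 0 \<Longrightarrow> chord a b a = 1" "det2 a b \<noteq> 0 \<Longrightarrow> chord a b b = 1"
  by (auto simp: chord_def)

text \<open>Write \<open>x = l a + m b\<close> with \<open>l + m > 1\<close>. If one coefficient
  were not positive, the reverse triangle inequality would give \<open>x\<close> a norm greater than
  1.\<close>

lemma unit_beyond_chord:
  assumes "norm a = 1" "norm b = 1" "norm x = 1" and d: "0 < det2 a b" and gt: "1 < chord a b x"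
  shows "0 < det2 a x \<and> 0 < det2 x b"
proof -
  define l where "l = det2 x b / det2 a b"
  define m where "m = det2 a x / det2 a b"
  have x: "x = l *\<^sub>R a + m *\<^sub>R b"
    unfolding l_def m_def using d by (intro det2_cramer') auto
  have lm: "1 < l + m"
    using gt by (simp add: chord_def l_def m_def add_divide_distrib)
  have "0 < l"
  proof (rule ccontr)
    assume "\<not> 0 < l"
    then have "1 < \<bar>m\<bar> - \<bar>l\<bar>" using lm by auto
    also have "\<dots> \<le> norm (m *\<^sub>R b + l *\<^sub>R a)"
      using norm_diff_ineq[of "m *\<^sub>R b" "l *\<^sub>R a"] assms by simp
    finally show False using assms(3) x by (simp add: add.commute)
  qed
  moreover have "0 < m"
  proof (rule ccontr)
    assume "\<not> 0 < m"
    then have "1 < \<bar>l\<bar> - \<bar>m\<bar>" using lm by auto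
    also have "\<dots> \<le> norm (l *\<^sub>R a + m *\<^sub>R b)"
      using norm_diff_ineq[of "l *\<^sub>R a" "m *\<^sub>R b"] assms by simp
    finally show False using assms(3) x by simp
  qed
  ultimately show ?thesis
    using d by (simp add: l_def m_def zero_less_divide_iff)
qed

lemma inner_unit_less_1:
  fixes a b :: "'a::real_inner"
  assumes "norm a = 1" "norm b = 1" "a \<noteq> b"
  shows "a \<bullet> b < 1"
proof -
  have "0 < (norm (a - b))\<^sup>2" using assms by simp
  also have "(norm (a - b))\<^sup>2 = 2 - 2 * (a \<bullet> b)"
    using assms by (simp add: power2_norm_eq_inner inner_diff norm_eq_1 inner_commute)
  finally show ?thesis by simp
qed

text \<open>A line meets the circle in at most two points: for \<open>x = l a + m b\<close> with
  \<open>l + m = 1\<close>, norm 1 means \<open>l m (1 - a \<bullet> b) = 0\<close>, and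
  \<open>a \<bullet> b < 1\<close>.\<close>

lemma unit_on_chord:
  assumes n: "norm a = 1" "norm b = 1" "norm x = 1" and d: "0 < det2 a b" and eq: "chord a b x = 1"
  shows "x = a \<or> x = b"
proof -
  define l where "l = det2 x b / det2 a b"
  define m where "m = det2 a x / det2 a b"
  have x: "x = l *\<^sub>R a + m *\<^sub>R b"
    unfolding l_def m_def using d by (intro det2_cramer') auto
  have lm: "m = 1 - l"
    using eq by (simp add: chord_def l_def m_def add_divide_distrib)
  have "a \<bullet> b < 1" using n d by (intro inner_unit_less_1) auto
  moreover have "1 = l * l + m * m + 2 * l * m * (a \<bullet> b)"
  proof -
    have "1 = x \<bullet> x" using n by (simp add: norm_eq_1)
    also have "\<dots> = l * l + m * m + 2 * l * m * (a \<bullet> b)"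
      unfolding x using n by (simp add: norm_eq_1 inner_add algebra_simps inner_commute)
    finally show ?thesis .
  qed
  then have "l * m * (1 - a \<bullet> b) = 0"
    unfolding lm by (simp add: algebra_simps)
  ultimately have "l = 0 \<or> m = 0" by auto
  then show ?thesis using x lm by auto
qed

text \<open>The linear form \<open>chord a b\<close> is 1 at the crossing point, so it exceeds 1 at
  \<open>c\<close> or at \<open>d\<close> unless it equals 1 at both. The latter would make
  \<open>c\<close> and \<open>d\<close> the ends of the first chord, and a unit vector where the
  form exceeds 1 lies in the sector.\<close>

lemma crossing_chord_sector:
  assumes n: "norm a = 1" "norm b = 1" "norm c = 1" "norm d = 1" and ab: "0 < det2 a b"
    and x: "x \<in> open_segment a b" "x \<in> open_segment c d" and ne: "{a, b} \<noteq> {c, d}"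
  shows "(0 < det2 a c \<and> 0 < det2 c b) \<or> (0 < det2 a d \<and> 0 < det2 d b)"
proof -
  obtain s where s: "x = (1 - s) *\<^sub>R a + s *\<^sub>R b"
    using x(1) by (auto simp: in_segment)
  obtain t where t: "x = (1 - t) *\<^sub>R c + t *\<^sub>R d" "0 < t" "t < 1" "c \<noteq> d"
    using x(2) by (auto simp: in_segment)
  note lin = linear_add[OF linear_chord] linear_scale[OF linear_chord]
  have "chord a b x = 1"
    using ab by (simp add: s lin chord_ends)
  then have f: "(1 - t) * chord a b c + t * chord a b d = 1"
    by (simp add: t(1) lin)
  have "1 < chord a b c \<or> 1 < chord a b d"
  proof (rule ccontr)
    assume "\<not> ?thesis"
    then have le: "chord a b c \<le> 1" "chord a b d \<le> 1" by auto
    have "0 \<le> (1 - t) * (1 - chord a b c)" "0 \<le> t * (1 - chord a b d)"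
      using le t by auto
    moreover have "(1 - t) * (1 - chord a b c) + t * (1 - chord a b d) = 0"
      using f by (simp add: algebra_simps)
    ultimately have "(1 - t) * (1 - chord a b c) = 0" "t * (1 - chord a b d) = 0"
      by linarith+
    then have "chord a b c = 1" "chord a b d = 1" using t by auto
    then have "c = a \<or> c = b" "d = a \<or> d = b"
      using unit_on_chord n ab by blast+
    then show False using ne t(4) by auto
  qed
  then show ?thesis using unit_beyond_chord n ab by blast
qed

section \<open>Angular order of unit vectors\<close>

lemma polar_coordinates:
  fixes v :: "real^2"
  assumes "norm v = 1"
  obtains t where "0 \<le> t" "t < 2 * pi" "v $ 1 = cos t" "v $ 2 = sin t"
proof -
  have "(v $ 1)\<^sup>2 + (v $ 2)\<^sup>2 = 1"
    using assms by (simp add: norm_eq_1 inner_vec_def sum_2 power2_eq_square)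
  then show ?thesis using sincos_total_2pi that by metis
qed

text \<open>A difference of two angles from [0, 2\<pi>) lies in this window; values below -\<pi>
  belong to counterclockwise turns that pass angle 0.\<close>

lemma sin_pos_iff_window:
  assumes "- (2 * pi) < x" "x < 2 * pi"
  shows "0 < sin x \<longleftrightarrow> (0 < x \<and> x < pi) \<or> x < - pi"
proof -
  consider "x < - pi" | "- pi \<le> x" "x \<le> 0" | "0 < x" "x < pi" | "pi \<le> x" by linarith
  then show ?thesis
  proof cases
    case 1
    have "0 < sin (x + 2 * pi)" using 1 assms by (intro sin_gt_zero) auto
    then show ?thesis using 1 by simp
  next
    case 2
    have "0 \<le> sin (- x)" using 2 by (intro sin_ge_zero) auto
    then show ?thesis using 2 by simp
  next
    case 3
    then show ?thesis using sin_gt_zero by auto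
  next
    case 4
    have "0 \<le> sin (x - pi)" using 4 assms by (intro sin_ge_zero) auto
    then show ?thesis using 4 by (simp add: sin_diff) (use pi_gt_zero in linarith)
  qed
qed

text \<open>The vectors are sorted by angle. Assumption \<open>left\<close> forbids angular gaps of
  \<pi> or more, so each vector and its cyclic successor span a sector that \<open>det2\<close> can
  describe.\<close>

lemma cyclic_angular_order:
  assumes fin: "finite T" and unit: "\<And>v. v \<in> T \<Longrightarrow> norm v = 1" and ne: "T \<noteq> {}"
    and left: "\<And>a. a \<in> T \<Longrightarrow> \<exists>s\<in>T. 0 < det2 a s"
  obtains vs where "distinct vs" "set vs = T"
    "\<And>i s. i < length vs \<Longrightarrow> s \<in> T \<Longrightarrow>
       \<not> (0 < det2 (vs ! i) s \<and> 0 < det2 s (vs ! (Suc i mod length vs)))"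
    "\<And>i. i < length vs \<Longrightarrow> 0 < det2 (vs ! i) (vs ! (Suc i mod length vs))"
    "\<And>y. norm y = 1 \<Longrightarrow> \<exists>i<length vs. 0 \<le> det2 (vs ! i) y \<and> 0 \<le> det2 y (vs ! (Suc i mod length vs))"
proof -
  have "\<exists>t. norm v = 1 \<longrightarrow> 0 \<le> t \<and> t < 2 * pi \<and> v $ 1 = cos t \<and> v $ 2 = sin t" for v :: "real^2"
    using polar_coordinates by metis
  then obtain \<theta> where \<theta>: "0 \<le> \<theta> v" "\<theta> v < 2 * pi" "v $ 1 = cos (\<theta> v)" "v $ 2 = sin (\<theta> v)"
    if "norm v = 1" for v :: "real^2"
    by metis
  have det: "det2 u v = sin (\<theta> v - \<theta> u)" if "norm u = 1" "norm v = 1" for u v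
    using that by (simp add: det2_def \<theta> sin_diff)
  have pos: "0 < det2 u v \<longleftrightarrow> (\<theta> u < \<theta> v \<and> \<theta> v - \<theta> u < pi) \<or> \<theta> v - \<theta> u < - pi"
    if "norm u = 1" "norm v = 1" for u v
    unfolding det[OF that] using \<theta>[OF that(1)] \<theta>[OF that(2)]
    by (subst sin_pos_iff_window) auto
  have inj: "inj_on \<theta> T"
  proof (rule inj_onI)
    fix u v assume uv: "u \<in> T" "v \<in> T" "\<theta> u = \<theta> v"
    show "u = v"
      using \<theta>(3,4)[OF unit[OF uv(1)]] \<theta>(3,4)[OF unit[OF uv(2)]] uv(3) by (simp add: vec_eq_iff forall_2)
  qed
  obtain xs where xs: "set xs = T" "distinct xs"
    using finite_distinct_list[OF fin] by blast
  define vs where "vs = sort_key \<theta> xs"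
  have set: "set vs = T" and dist: "distinct vs" and sorted: "sorted (map \<theta> vs)"
    using xs by (simp_all add: vs_def)
  have len: "0 < length vs" using set ne by auto
  have mono: "\<theta> (vs ! i) < \<theta> (vs ! j)" if "i < j" "j < length vs" for i j
  proof -
    have "\<theta> (vs ! i) \<le> \<theta> (vs ! j)"
      using sorted_nth_mono[OF sorted, of i j] that by simp
    moreover have "vs ! i \<noteq> vs ! j"
      using that dist by (simp add: nth_eq_iff_index_eq)
    then have "\<theta> (vs ! i) \<noteq> \<theta> (vs ! j)"
      using inj_onD[OF inj, of "vs ! i" "vs ! j"] nth_mem[of i vs] nth_mem[of j vs] that set by auto
    ultimately show ?thesis by simp
  qed
  have in_T: "vs ! i \<in> T" if "i < length vs" for i using that set by auto
  have idx: "\<exists>j<length vs. s = vs ! j" if "s \<in> T" for s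
    using that unfolding set[symmetric] in_set_conv_nth by auto
  have nxt: "\<theta> (vs ! i) < \<theta> s \<longleftrightarrow> \<theta> (vs ! Suc i) \<le> \<theta> s" if i: "Suc i < length vs" and s: "s \<in> T" for i s
  proof -
    obtain j where j: "j < length vs" "s = vs ! j" using idx[OF s] by blast
    consider "j = i" | "j < i" | "j = Suc i" | "Suc i < j" by linarith
    then show ?thesis
      unfolding j(2) using mono[of i "Suc i"] mono[of j i] mono[of "Suc i" j] mono[of i j] j(1) i
      by cases auto
  qed
  have first: "\<theta> (vs ! 0) \<le> \<theta> s" "\<theta> s \<le> \<theta> (vs ! (length vs - 1))" if s: "s \<in> T" for s
  proof -
    obtain j where j: "j < length vs" "s = vs ! j" using idx[OF s] by blast
    show "\<theta> (vs ! 0) \<le> \<theta> s" using mono[of 0 j] j by (cases "j = 0") auto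
    consider "j < length vs - 1" | "j = length vs - 1" using j by linarith
    then show "\<theta> s \<le> \<theta> (vs ! (length vs - 1))"
      by cases (use mono[of j "length vs - 1"] j len in auto)
  qed
  have step: "0 < det2 a b \<and> (\<forall>s\<in>T. \<not> (0 < det2 a s \<and> 0 < det2 s b)) \<and>
      (\<forall>y. norm y = 1 \<longrightarrow> \<theta> a \<le> \<theta> y \<longrightarrow> \<theta> y < \<theta> b \<longrightarrow> 0 \<le> det2 a y \<and> 0 \<le> det2 y b)"
    if ab: "a \<in> T" "b \<in> T" "\<theta> a < \<theta> b" and between: "\<And>s. s \<in> T \<Longrightarrow> \<theta> a < \<theta> s \<longleftrightarrow> \<theta> b \<le> \<theta> s" for a b
  proof -
    note u = unit[OF ab(1)] unit[OF ab(2)]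
    obtain s where s: "s \<in> T" "0 < det2 a s" using left ab by blast
    \<comment> \<open>A vector to the left of \<open>a\<close> either has a larger angle, which is
      then at least that of \<open>b\<close>, or an angle smaller by more than \<pi>. In the second
      case the angle of \<open>a\<close> exceeds \<pi>, and that of \<open>b\<close> is below
      2\<pi>.\<close>
    have lt: "\<theta> b - \<theta> a < pi"
      using s between[OF s(1)] pos[OF u(1) unit[OF s(1)]] \<theta>[OF u(1)] \<theta>[OF u(2)] \<theta>[OF unit[OF s(1)]]
      by linarith
    have 1: "0 < det2 a b" using lt ab(3) pos[OF u] by simp
    have 2: "\<not> (0 < det2 a t \<and> 0 < det2 t b)" if "t \<in> T" for t
      using between[OF that] pos[OF u(1) unit[OF that]] pos[OF unit[OF that] u(2)] lt ab(3) by linarith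
    have 3: "0 \<le> det2 a y \<and> 0 \<le> det2 y b" if y: "norm y = 1" "\<theta> a \<le> \<theta> y" "\<theta> y < \<theta> b" for y
    proof -
      have "0 \<le> sin (\<theta> y - \<theta> a)" "0 \<le> sin (\<theta> b - \<theta> y)"
        using y lt by (intro sin_ge_zero; linarith)+
      then show ?thesis using det y(1) u by simp
    qed
    show ?thesis using 1 2 3 by blast
  qed
  \<comment> \<open>The sector that wraps around angle 0, from the largest angle to the
    smallest.\<close>
  have wrap: "0 < det2 a b \<and> (\<forall>s\<in>T. \<not> (0 < det2 a s \<and> 0 < det2 s b)) \<and>
      (\<forall>y. norm y = 1 \<longrightarrow> \<theta> a \<le> \<theta> y \<or> \<theta> y < \<theta> b \<longrightarrow> 0 \<le> det2 a y \<and> 0 \<le> det2 y b)"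
    if ab: "a \<in> T" "b \<in> T" and ext: "\<And>s. s \<in> T \<Longrightarrow> \<theta> b \<le> \<theta> s" "\<And>s. s \<in> T \<Longrightarrow> \<theta> s \<le> \<theta> a" for a b
  proof -
    note u = unit[OF ab(1)] unit[OF ab(2)]
    obtain s where s: "s \<in> T" "0 < det2 a s" using left ab by blast
    \<comment> \<open>No vector of \<open>T\<close> has a larger angle than \<open>a\<close>, so one
      to the left of \<open>a\<close> has an angle smaller by more than \<pi>, and that of
      \<open>b\<close> is at most as large.\<close>
    have lt: "\<theta> b - \<theta> a < - pi"
      using s ext[OF s(1)] pos[OF u(1) unit[OF s(1)]] by linarith
    have 1: "0 < det2 a b" using lt pos[OF u] by simp
    have 2: "\<not> (0 < det2 a t \<and> 0 < det2 t b)" if "t \<in> T" for t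
      using ext[OF that] pos[OF u(1) unit[OF that]] pos[OF unit[OF that] u(2)] \<theta>[OF u(1)] \<theta>[OF u(2)] lt
      by linarith
    have 3: "0 \<le> det2 a y \<and> 0 \<le> det2 y b" if y: "norm y = 1" "\<theta> a \<le> \<theta> y \<or> \<theta> y < \<theta> b" for y
    proof -
      have "\<not> 0 < det2 y a" "\<not> 0 < det2 b y"
        using y(2) lt pos[OF y(1) u(1)] pos[OF u(2) y(1)] \<theta>[OF u(1)] \<theta>[OF u(2)] \<theta>[OF y(1)]
        by linarith+
      then show ?thesis using det2_swap[of y a] det2_swap[of b y] by linarith
    qed
    show ?thesis using 1 2 3 by blast
  qed
  let ?n = "\<lambda>i. vs ! (Suc i mod length vs)"
  let ?l = "length vs - 1"
  have step': "0 < det2 (vs ! i) (?n i)" "\<forall>s\<in>T. \<not> (0 < det2 (vs ! i) s \<and> 0 < det2 s (?n i))"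
    if "i < length vs" for i
  proof -
    have "0 < det2 (vs ! i) (?n i) \<and> (\<forall>s\<in>T. \<not> (0 < det2 (vs ! i) s \<and> 0 < det2 s (?n i)))"
    proof (cases "Suc i < length vs")
      case True
      then show ?thesis using step[of "vs ! i" "?n i"] nxt[OF True] mono[of i "Suc i"] in_T by auto
    next
      case False
      then have "Suc i = length vs" "i = ?l" using that by auto
      then show ?thesis using wrap[of "vs ! i" "?n i"] first in_T len by auto
    qed
    then show "0 < det2 (vs ! i) (?n i)" "\<forall>s\<in>T. \<not> (0 < det2 (vs ! i) s \<and> 0 < det2 s (?n i))" by auto
  qed
  have cover: "\<exists>i<length vs. 0 \<le> det2 (vs ! i) y \<and> 0 \<le> det2 y (?n i)" if y: "norm y = 1" for y
  proof (cases "\<theta> y < \<theta> (vs ! 0) \<or> \<theta> (vs ! ?l) \<le> \<theta> y")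
    case True
    have "?n ?l = vs ! 0" using len by simp
    then show ?thesis using wrap[of "vs ! ?l" "vs ! 0"] first in_T len y True
      by (intro exI[of _ ?l]) auto
  next
    case False
    \<comment> \<open>The sector of \<open>y\<close> starts at the last vector whose angle does not
      exceed that of \<open>y\<close>.\<close>
    define J where "J = {j. j < length vs \<and> \<theta> (vs ! j) \<le> \<theta> y}"
    have J: "finite J" "J \<noteq> {}" using False len by (auto simp: J_def)
    obtain i where i: "i = Max J" by simp
    have "i \<in> J" unfolding i by (rule Max_in[OF J])
    then have i': "i < length vs" "\<theta> (vs ! i) \<le> \<theta> y" by (auto simp: J_def)
    have "i \<noteq> ?l" using i'(2) False by auto
    then have "Suc i < length vs" using i'(1) by linarith
    moreover have "Suc i \<notin> J" using Max_ge[OF J(1), of "Suc i"] i by auto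
    then have "\<theta> y < \<theta> (vs ! Suc i)" using calculation by (auto simp: J_def)
    ultimately show ?thesis
      using step[of "vs ! i" "vs ! Suc i"] nxt[of i] mono[of i "Suc i"] in_T y i'
      by (intro exI[of _ i]) auto
  qed
  show ?thesis
    by (rule that[OF dist set]) (use step' cover in auto)
qed

section \<open>Regions bounded by convex polygons\<close>

text \<open>By Cramer's rule \<open>x\<close> is a positive combination of \<open>u\<close> and
  \<open>v\<close>, and the conclusion is linear in \<open>x\<close>.\<close>

lemma sector_det2:
  assumes "0 < det2 u v" "0 < det2 u x" "0 < det2 x v" "0 \<le> det2 u w" "0 < det2 v w"
  shows "0 < det2 x w"
proof -
  have "det2 u v * det2 x w = det2 x v * det2 u w + det2 u x * det2 v w"
    by (simp add: det2_def algebra_simps)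
  moreover have "0 < det2 x v * det2 u w + det2 u x * det2 v w"
    using assms by (intro add_nonneg_pos mult_pos_pos mult_nonneg_nonneg) auto
  ultimately show ?thesis using assms(1) by (metis zero_less_mult_pos)
qed

lemma sector_det2_left:
  assumes "0 < det2 u v" "0 < det2 u x" "0 < det2 x v" "0 < det2 w u" "0 \<le> det2 w v"
  shows "0 < det2 w x"
proof -
  have "det2 u v * det2 w x = det2 x v * det2 w u + det2 u x * det2 w v"
    by (simp add: det2_def algebra_simps)
  moreover have "0 < det2 x v * det2 w u + det2 u x * det2 w v"
    using assms by (intro add_pos_nonneg mult_pos_pos mult_nonneg_nonneg) auto
  ultimately show ?thesis using assms(1) by (metis zero_less_mult_pos)
qed

lemma det2_sgn_pos [simp]:
  assumes "u \<noteq> 0"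
  shows "0 < det2 (sgn u) v \<longleftrightarrow> 0 < det2 u v" "0 < det2 v (sgn u) \<longleftrightarrow> 0 < det2 v u"
  using assms by (simp_all add: sgn_div_norm zero_less_divide_iff zero_less_mult_iff)

lemma interior_extend:
  fixes S :: "'a::real_normed_vector set"
  assumes "y \<in> interior S"
  obtains e where "0 < e" "y + e *\<^sub>R w \<in> S"
proof -
  obtain r where r: "0 < r" "ball y r \<subseteq> S" using assms by (auto simp: mem_interior)
  define k where "k = norm w + 1"
  have k: "0 < k" "norm w < k" using norm_ge_zero[of w] by (auto simp: k_def simp del: norm_ge_zero)
  have "r * norm w < r * k" using r k by simp
  then have "y + (r / k) *\<^sub>R w \<in> ball y r"
    using r k by (simp add: dist_norm divide_less_eq)
  then show ?thesis using that[of "r / k"] r k by auto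
qed

lemma scale_in_interior:
  fixes S :: "'a::euclidean_space set"
  assumes "convex S" "0 \<in> interior S" "x \<in> S" "0 \<le> t" "t < 1"
  shows "t *\<^sub>R x \<in> interior S"
  using mem_interior_convex_shrink[OF assms(1-3), of "1 - t"] assms(4,5) by (simp add: algebra_simps)

text \<open>The solid form of a convex polygon, with the point \<open>o\<close> moved to the origin.
  The edges of the graph enter through the frontier.\<close>

definition region :: "(real^2) set set \<Rightarrow> (real^2) set \<Rightarrow> bool" where
  "region E K \<longleftrightarrow> compact K \<and> convex K \<and> 0 \<in> interior K \<and> (\<exists>F\<subseteq>E. frontier K = drawing F)"

lemma region_frontier_edge:
  assumes G: "plane_straight_line_graph V E" and K: "region E K" and x: "x \<in> frontier K"
  obtains a b where "{a, b} \<in> E" "a \<in> V \<inter> frontier K" "b \<in> V \<inter> frontier K" "a \<noteq> b"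
    "x \<in> closed_segment a b"
proof -
  obtain F where F: "F \<subseteq> E" "frontier K = drawing F" using K by (auto simp: region_def)
  then obtain e where e: "e \<in> F" "x \<in> convex hull e" using x by (auto simp: drawing_def)
  then have "e \<subseteq> V" "card e = 2" using G F by (auto simp: plane_straight_line_graph_def)
  then obtain a b where ab: "e = {a, b}" "a \<noteq> b" "a \<in> V" "b \<in> V"
    by (auto simp: card_2_iff)
  have "a \<in> drawing F" "b \<in> drawing F"
    using e(1) ab(1) unfolding drawing_def by (blast intro: hull_inc)+
  then show ?thesis
    using that[of a b] e ab F by (auto simp: segment_convex_hull)
qed

lemma region_closed: "region E K \<Longrightarrow> closed K"
  by (simp add: region_def compact_imp_closed)

lemma region_frontier_subset: "region E K \<Longrightarrow> frontier K \<subseteq> K"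
  by (simp add: region_closed frontier_subset_closed)

text \<open>A compact convex set is the hull of its extreme points. These lie on the frontier, hence
  on edges, and an inner point of an edge is not extreme. So the vertices in \<open>K\<close>
  determine \<open>K\<close>.\<close>

lemma region_eq_hull:
  assumes G: "plane_straight_line_graph V E" and K: "region E K"
  shows "K = convex hull (V \<inter> K)"
proof
  have cc: "compact K" "convex K" using K by (auto simp: region_def)
  have "x \<in> V \<inter> K" if x: "x extreme_point_of K" for x
  proof -
    have xK: "x \<in> K" using x by (simp add: extreme_point_of_def)
    have "x \<in> frontier K"
      using extreme_point_not_in_interior[OF x] xK closure_subset by (auto simp: frontier_def)
    then obtain a b where ab: "a \<in> V \<inter> frontier K" "b \<in> V \<inter> frontier K" "x \<in> closed_segment a b"
      using region_frontier_edge[OF G K] by blast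
    then have "a \<in> K" "b \<in> K" using region_frontier_subset[OF K] by auto
    then have "x \<notin> open_segment a b" using x by (simp add: extreme_point_of_def)
    then show ?thesis using ab xK by (auto simp: open_segment_def)
  qed
  then have "convex hull {x. x extreme_point_of K} \<subseteq> convex hull (V \<inter> K)"
    by (intro hull_mono) auto
  then show "K \<subseteq> convex hull (V \<inter> K)" using Krein_Milman_Minkowski[OF cc] by simp
  show "convex hull (V \<inter> K) \<subseteq> K" using cc by (intro hull_minimal) auto
qed

text \<open>A supporting line at \<open>z\<close> touches \<open>K\<close> strictly inside a segment
  of \<open>K\<close>, so it contains the whole segment. Hence \<open>K\<close> lies on the origin's
  side of the line through \<open>p\<close> and \<open>q\<close>.\<close>

lemma frontier_segment_chord_le:
  assumes K: "region E K" and d: "0 < det2 p q" and pq: "p \<in> K" "q \<in> K"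
    and z: "z \<in> open_segment p q" "z \<in> frontier K" and x: "x \<in> K"
  shows "chord p q x \<le> 1"
proof -
  have int: "interior K \<noteq> {}" "convex K" "0 \<in> interior K" using K by (auto simp: region_def)
  have "z \<in> K" "z \<notin> rel_interior K"
    using z region_frontier_subset[OF K] rel_interior_nonempty_interior[OF int(1)]
    by (auto simp: frontier_def)
  then obtain a where a: "a \<noteq> 0" "\<And>y. y \<in> K \<Longrightarrow> a \<bullet> z \<le> a \<bullet> y"
    using supporting_hyperplane_rel_boundary[OF int(2)] by metis
  obtain s where s: "z = (1 - s) *\<^sub>R p + s *\<^sub>R q" "0 < s" "s < 1"
    using z(1) by (auto simp: in_segment)
  have "a \<bullet> z \<le> a \<bullet> p" "a \<bullet> z \<le> a \<bullet> q" using a pq by auto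
  moreover have "(1 - s) * (a \<bullet> p - a \<bullet> z) + s * (a \<bullet> q - a \<bullet> z) = 0"
    by (simp add: s(1) inner_add algebra_simps)
  moreover have "0 \<le> (1 - s) * (a \<bullet> p - a \<bullet> z)" "0 \<le> s * (a \<bullet> q - a \<bullet> z)"
    using s calculation by (auto intro!: mult_nonneg_nonneg)
  ultimately have "(1 - s) * (a \<bullet> p - a \<bullet> z) = 0" "s * (a \<bullet> q - a \<bullet> z) = 0" by linarith+
  then have eq: "a \<bullet> p = a \<bullet> z" "a \<bullet> q = a \<bullet> z" using s by auto
  \<comment> \<open>As the origin is interior, \<open>K\<close> contains a small multiple of
    \<open>- a\<close>, which makes the supporting functional negative at \<open>z\<close>.\<close>
  obtain e where e: "0 < e" "0 + e *\<^sub>R (- a) \<in> K" using interior_extend[OF int(3)] .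
  then have "a \<bullet> z \<le> - (e * (a \<bullet> a))" using a(2)[OF e(2)] by simp
  moreover have "0 < e * (a \<bullet> a)" using e a by simp
  ultimately have neg: "a \<bullet> z < 0" by linarith
  have "a \<bullet> x = (det2 x q / det2 p q) * (a \<bullet> p) + (det2 p x / det2 p q) * (a \<bullet> q)"
    by (subst det2_cramer'[of p q x]) (use d in \<open>simp_all add: inner_add\<close>)
  also have "\<dots> = chord p q x * (a \<bullet> z)"
    by (simp add: eq chord_def add_divide_distrib distrib_right)
  finally have "chord p q x * (a \<bullet> z) \<ge> 1 * (a \<bullet> z)" using a(2)[OF x] by simp
  then show ?thesis using neg by (simp add: mult_le_cancel_right)
qed

text \<open>Shrinking a point of \<open>K\<close> towards the interior point 0 gives an interior
  point, so a ray from 0 crosses the frontier only once.\<close>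

lemma region_ray:
  assumes K: "region E K" and y: "y \<noteq> 0"
  obtains s where "0 < s" "s *\<^sub>R y \<in> frontier K" "\<And>t. 0 \<le> t \<Longrightarrow> t < s \<Longrightarrow> t *\<^sub>R y \<in> interior K"
    "\<And>t. s < t \<Longrightarrow> t *\<^sub>R y \<notin> K"
proof -
  have K': "bounded K" "convex K" "0 \<in> interior K" using K by (auto simp: region_def compact_imp_bounded)
  obtain s where s: "0 < s" "s *\<^sub>R y \<in> frontier K" "\<And>t. 0 \<le> t \<Longrightarrow> t < s \<Longrightarrow> t *\<^sub>R y \<in> interior K"
    using ray_to_frontier[OF K'(1,3) y] by auto
  have "t *\<^sub>R y \<notin> K" if t: "s < t" for t
  proof
    assume "t *\<^sub>R y \<in> K"
    then have "(s / t) *\<^sub>R (t *\<^sub>R y) \<in> interior K"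
      using s t by (intro scale_in_interior K') auto
    then show False using s t by (simp add: frontier_def)
  qed
  then show ?thesis using that s by blast
qed

text \<open>The ray through \<open>b\<close> leaves the closed set \<open>L\<close> strictly before
  \<open>b\<close>, and leaves \<open>K\<close> not before \<open>b\<close>. The point halfway
  between the exit from \<open>L\<close> and \<open>b\<close> serves.\<close>

lemma region_ray_between:
  assumes K: "region E K" and L: "region E L" and b: "b \<in> K" "b \<notin> L"
  obtains t where "0 < t" "t *\<^sub>R b \<in> interior K" "t *\<^sub>R b \<notin> L"
proof -
  have b0: "b \<noteq> 0" using b L interior_subset by (auto simp: region_def)
  obtain s where s: "\<And>t. s < t \<Longrightarrow> t *\<^sub>R b \<notin> K" "\<And>t. 0 \<le> t \<Longrightarrow> t < s \<Longrightarrow> t *\<^sub>R b \<in> interior K"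
    using region_ray[OF K b0] by metis
  obtain r where r: "0 < r" "r *\<^sub>R b \<in> frontier L" "\<And>t. 0 \<le> t \<Longrightarrow> t < r \<Longrightarrow> t *\<^sub>R b \<in> interior L"
    "\<And>t. r < t \<Longrightarrow> t *\<^sub>R b \<notin> L"
    using region_ray[OF L b0] by metis
  have "1 \<le> s" using s(1)[of 1] b by force
  moreover have "r < 1"
  proof (rule ccontr)
    assume "\<not> r < 1"
    then consider "r = 1" | "1 < r" by linarith
    then show False
      by cases (use r(2) r(3)[of 1] b region_frontier_subset[OF L] interior_subset in auto)
  qed
  ultimately show ?thesis
    using that[of "(r + 1) / 2"] r s by auto
qed

text \<open>In the direction of \<open>b\<close> the set \<open>K\<close> reaches farther, in that
  of \<open>c\<close> the set \<open>L\<close>. Both are open conditions on a direction and exclude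
  each other, so by connectedness of the segment from \<open>b\<close> to \<open>c\<close> some
  direction between satisfies neither. There the ray leaves both sets at the same point.\<close>

lemma regions_cross_frontier:
  assumes K: "region E K" and L: "region E L"
    and b: "b \<in> K" "b \<notin> L" and c: "c \<in> L" "c \<notin> K" and d: "0 < det2 b c"
  obtains z where "z \<in> frontier K" "z \<in> frontier L" "0 < det2 b z" "0 < det2 z c"
proof -
  \<comment> \<open>For regions, \<open>A K L\<close> consists of the directions in which
    \<open>K\<close> reaches farther than \<open>L\<close>.\<close>
  define A where "A = (\<lambda>K L. \<Union>t\<in>{0<..}. (\<lambda>y. t *\<^sub>R y) -` (interior K - L) :: (real^2) set)"
  have op: "open (A K L)" if "region E K" "region E L" for K L
    unfolding A_def using region_closed[OF that(2)]
    by (intro open_UN ballI continuous_open_vimage continuous_intros open_Diff) auto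
  have disj: "A K L \<inter> A L K = {}"
  proof -
    have False if st: "0 < s" "0 < t" "s *\<^sub>R y \<in> interior K - L" "t *\<^sub>R y \<in> interior L - K" for s t y
    proof -
      have sub: "u *\<^sub>R y \<in> M" if "region E M" "v *\<^sub>R y \<in> M" "0 < u" "u \<le> v" for u v M
      proof (cases "u = v")
        case False
        then have "(u / v) *\<^sub>R (v *\<^sub>R y) \<in> interior M"
          using that by (intro scale_in_interior) (auto simp: region_def)
        then show ?thesis using that interior_subset by auto
      qed (use that in auto)
      consider "s \<le> t" | "t \<le> s" by linarith
      then show False
        by cases (use sub[OF L, of t s] sub[OF K, of s t] st interior_subset in auto)
    qed
    then show ?thesis by (auto simp: A_def)
  qed
  have bA: "b \<in> A K L" using region_ray_between[OF K L b] by (force simp: A_def)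
  have cA: "c \<in> A L K" using region_ray_between[OF L K c] by (force simp: A_def)
  have "\<not> closed_segment b c \<subseteq> A K L \<union> A L K"
  proof
    assume "closed_segment b c \<subseteq> A K L \<union> A L K"
    then have "A K L \<inter> closed_segment b c = {} \<or> A L K \<inter> closed_segment b c = {}"
      using disj by (intro connectedD[OF connected_segment(1) op[OF K L] op[OF L K]]) auto
    then show False using bA cA by auto
  qed
  then obtain y where y: "y \<in> closed_segment b c" "y \<notin> A K L" "y \<notin> A L K" by auto
  have "y \<noteq> b" "y \<noteq> c" using y bA cA by auto
  then have "y \<in> open_segment b c" using y(1) by (simp add: open_segment_def)
  then obtain u where u: "y = (1 - u) *\<^sub>R b + u *\<^sub>R c" "0 < u" "u < 1"
    by (auto simp: in_segment(2))
  then have dy: "0 < det2 b y" "0 < det2 y c" using d by simp_all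
  then have y0: "y \<noteq> 0" by auto
  obtain s where s: "0 < s" "s *\<^sub>R y \<in> frontier K" "\<And>t. 0 \<le> t \<Longrightarrow> t < s \<Longrightarrow> t *\<^sub>R y \<in> interior K"
    "\<And>t. s < t \<Longrightarrow> t *\<^sub>R y \<notin> K"
    using region_ray[OF K y0] by metis
  obtain r where r: "0 < r" "r *\<^sub>R y \<in> frontier L" "\<And>t. 0 \<le> t \<Longrightarrow> t < r \<Longrightarrow> t *\<^sub>R y \<in> interior L"
    "\<And>t. r < t \<Longrightarrow> t *\<^sub>R y \<notin> L"
    using region_ray[OF L y0] by metis
  \<comment> \<open>Halfway between the two exits the ray would be inside \<open>K\<close> but
    outside \<open>L\<close>, so \<open>y\<close> would be in \<open>A K L\<close>.\<close>
  have "\<not> r < s"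
  proof
    assume "r < s"
    then have "((r + s) / 2) *\<^sub>R y \<in> interior K - L" using r(1,4) s(3) by auto
    then show False using y(2) r(1) s(1) unfolding A_def by (auto dest: bspec[of _ _ "(r + s) / 2"])
  qed
  moreover have "\<not> s < r"
  proof
    assume "s < r"
    then have "((r + s) / 2) *\<^sub>R y \<in> interior L - K" using s(1,4) r(3) by auto
    then show False using y(3) r(1) s(1) unfolding A_def by (auto dest: bspec[of _ _ "(r + s) / 2"])
  qed
  ultimately have "r = s" by linarith
  then show ?thesis using that[of "s *\<^sub>R y"] s r dy by simp
qed

text \<open>The frontiers meet at a point \<open>z\<close> between the directions of
  \<open>b\<close> and \<open>c\<close>. If \<open>z\<close> is no vertex, it lies inside an edge of
  each frontier, and in a plane graph these edges are equal; an end of this common edge is the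
  vertex sought.\<close>

lemma regions_common_vertex:
  assumes G: "plane_straight_line_graph V E" and gen: "\<And>u v. u \<in> V \<Longrightarrow> v \<in> V \<Longrightarrow> u \<noteq> v \<Longrightarrow> det2 u v \<noteq> 0"
    and K: "region E K" and L: "region E L"
    and b: "b \<in> V" "b \<in> K" "b \<notin> L" and c: "c \<in> V" "c \<in> L" "c \<notin> K" and d: "0 < det2 b c"
  obtains x where "x \<in> V" "x \<in> K" "x \<in> L" "0 < det2 b x" "0 < det2 x c"
proof -
  obtain z where z: "z \<in> frontier K" "z \<in> frontier L" "0 < det2 b z" "0 < det2 z c"
    using regions_cross_frontier[OF K L b(2,3) c(2,3) d] .
  note result = that
  note sub = region_frontier_subset[OF K] region_frontier_subset[OF L]
  show ?thesis
  proof (cases "z \<in> V")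
    case True
    then show ?thesis using that z sub by blast
  next
    case False
    obtain p q where pq: "{p, q} \<in> E" "p \<in> V \<inter> frontier K" "q \<in> V \<inter> frontier K" "p \<noteq> q"
        "z \<in> closed_segment p q"
      by (rule region_frontier_edge[OF G K z(1)])
    obtain p' q' where pq': "{p', q'} \<in> E" "p' \<in> V \<inter> frontier L" "q' \<in> V \<inter> frontier L" "p' \<noteq> q'"
        "z \<in> closed_segment p' q'"
      by (rule region_frontier_edge[OF G L z(2)])
    have "z \<in> open_segment p q \<inter> open_segment p' q'"
      using pq pq' False by (auto simp: open_segment_def)
    then have zo: "z \<in> open_segment p q" and eq: "{p, q} = {p', q'}"
      using plane_open_segments_eq[OF G pq(1) pq'(1)] by auto
    have pqL: "p \<in> L" "q \<in> L" using pq' eq sub by (auto simp: doubleton_eq_iff)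
    have pqK: "p \<in> K" "q \<in> K" using pq sub by auto
    \<comment> \<open>Here \<open>p\<close> is the end on the clockwise side. If \<open>p\<close> is
      not in the sector, then \<open>b\<close> lies in the cone of \<open>p\<close> and
      \<open>q\<close> and not beyond the edge, hence in the triangle with corners \<open>0\<close>,
      \<open>p\<close>, \<open>q\<close>. This triangle is contained in \<open>L\<close>, but
      \<open>b\<close> is not.\<close>
    have main: thesis if d': "0 < det2 p q" and pq: "p \<in> V" "q \<in> V" "p \<in> K" "q \<in> K" "p \<in> L" "q \<in> L"
      and zo: "z \<in> open_segment p q" for p q
    proof (rule ccontr)
      assume no: "\<not> thesis"
      obtain t where t: "z = (1 - t) *\<^sub>R p + t *\<^sub>R q" "0 < t" "t < 1"
        using zo by (auto simp: in_segment)
      then have dz: "0 < det2 p z" "0 < det2 z q" using d' by simp_all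
      have "\<not> (0 < det2 b p \<and> 0 < det2 p c)" using no result pq by blast
      moreover have "0 < det2 p c" if "0 < det2 b p"
        using sector_det2[of b z p c] z d that dz by simp
      ultimately have "\<not> 0 < det2 b p" by blast
      moreover have "b \<noteq> p" using pq b by auto
      then have "det2 b p \<noteq> 0" using gen pq b by blast
      ultimately have bp: "0 < det2 p b" using det2_swap[of b p] by linarith
      then have bq: "0 < det2 b q"
        using sector_det2[of p z b q] dz z d' by simp
      define l where "l = det2 b q / det2 p q"
      define m where "m = det2 p b / det2 p q"
      have lm: "b = l *\<^sub>R p + m *\<^sub>R q" "0 < l" "0 < m"
        using d' bp bq det2_cramer'[of p q b] by (auto simp: l_def m_def)
      have "chord p q b \<le> 1"
        using frontier_segment_chord_le[OF K d' pq(3,4) zo z(1) b(2)] .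
      then have le1: "l + m \<le> 1" by (simp add: chord_def l_def m_def add_divide_distrib)
      have "0 \<in> L" "convex L" using L interior_subset by (auto simp: region_def)
      then have "convex hull {0, p, q} \<subseteq> L" using pq by (intro hull_minimal) auto
      moreover have "b = (1 - l - m) *\<^sub>R 0 + l *\<^sub>R p + m *\<^sub>R q" using lm(1) by simp
      then have "b \<in> convex hull {0, p, q}"
        unfolding convex_hull_3 using le1 lm
        by (intro CollectI exI[of _ "1 - l - m"] exI[of _ l] exI[of _ m]) auto
      ultimately show False using b(3) by blast
    qed
    have pqV: "p \<in> V" "q \<in> V" using pq by auto
    have "det2 p q \<noteq> 0" using gen[OF pqV pq(4)] .
    then consider "0 < det2 p q" | "0 < det2 q p" using det2_swap[of p q] by linarith
    then show ?thesis
    proof cases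
      case 1
      then show ?thesis by (rule main[OF _ pqV pqK pqL zo])
    next
      case 2
      have "z \<in> open_segment q p" using zo by (simp add: open_segment_commute)
      with 2 show ?thesis by (rule main[OF _ pqV(2,1) pqK(2,1) pqL(2,1)])
    qed
  qed
qed

section \<open>Projection to the unit circle\<close>

text \<open>For a set \<open>T\<close> of projected vertices, these pairs become the edges of the
  projected polygon.\<close>

definition consecutive :: "(real^2) set \<Rightarrow> real^2 \<Rightarrow> real^2 \<Rightarrow> bool" where
  "consecutive T a b \<longleftrightarrow> a \<in> T \<and> b \<in> T \<and> 0 < det2 a b \<and> (\<forall>s\<in>T. \<not> (0 < det2 a s \<and> 0 < det2 s b))"

text \<open>No point of \<open>T\<close> lies beyond the chord of a consecutive pair, since it would
  have to lie in the empty sector of this pair. So these chords bound the hull, and their sectors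
  cover all directions.\<close>

lemma unit_hull_cycle:
  assumes fin: "finite T" and unit: "\<And>v. v \<in> T \<Longrightarrow> norm v = 1" and int: "0 \<in> interior (convex hull T)"
  obtains vs where "distinct vs" "3 \<le> length vs" "set vs = T"
    "\<And>i. i < length vs \<Longrightarrow> consecutive T (vs ! i) (vs ! (Suc i mod length vs))"
    "frontier (convex hull T) = drawing (cyclic_edges vs)"
proof -
  have left: "\<exists>s\<in>T. 0 < det2 a s" if a: "a \<in> T" for a
  proof (rule ccontr)
    assume no: "\<not> ?thesis"
    \<comment> \<open>\<open>w\<close> is \<open>a\<close> turned counterclockwise by a right angle.
      If nothing of \<open>T\<close> were to the left of \<open>a\<close>, the hull would lie in a
      half-plane without positive multiples of \<open>w\<close>, although 0 is interior.\<close>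
    define w :: "real^2" where "w = vector [- a $ 2, a $ 1]"
    have aw: "det2 a w = 1"
      using unit[OF a] by (simp add: det2_def w_def norm_eq_1 inner_vec_def sum_2)
    have "convex hull T \<subseteq> {x. det2 a x \<le> 0}"
    proof (rule hull_minimal)
      have "convex (det2 a -` {..0})"
        by (intro convex_linear_vimage linear_det2_right) auto
      then show "convex {x. det2 a x \<le> 0}" by (simp add: vimage_def)
    qed (use no in auto)
    moreover obtain e where "0 < e" "0 + e *\<^sub>R w \<in> convex hull T"
      using interior_extend[OF int] .
    ultimately show False using aw by auto
  qed
  have ne: "T \<noteq> {}" using int by auto
  obtain vs where vs: "distinct vs" "set vs = T"
    "\<And>i s. i < length vs \<Longrightarrow> s \<in> T \<Longrightarrow>
       \<not> (0 < det2 (vs ! i) s \<and> 0 < det2 s (vs ! (Suc i mod length vs)))"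
    "\<And>i. i < length vs \<Longrightarrow> 0 < det2 (vs ! i) (vs ! (Suc i mod length vs))"
    "\<And>y. norm y = 1 \<Longrightarrow> \<exists>i<length vs. 0 \<le> det2 (vs ! i) y \<and> 0 \<le> det2 y (vs ! (Suc i mod length vs))"
    using cyclic_angular_order[OF fin unit ne left] by metis
  let ?n = "\<lambda>i. vs ! (Suc i mod length vs)"
  have pos: "0 < length vs" using vs(2) ne by auto
  \<comment> \<open>With one or two vectors \<open>det2\<close> would be positive on a vector and
    itself, or on a pair in both orders.\<close>
  have len: "3 \<le> length vs"
  proof (rule ccontr)
    assume "\<not> 3 \<le> length vs"
    then consider "length vs = 1" | "length vs = 2" using pos by linarith
    then show False
    proof cases
      case 1
      then show False using vs(4)[of 0] by simp
    next
      case 2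
      then show False using vs(4)[of 0] vs(4)[of 1] det2_swap[of "vs ! 0" "vs ! 1"] by simp
    qed
  qed
  have cons: "consecutive T (vs ! i) (?n i)" if "i < length vs" for i
  proof -
    have "vs ! i \<in> T" "?n i \<in> T" using that pos unfolding vs(2)[symmetric] by auto
    then show ?thesis using vs(3,4) that by (auto simp: consecutive_def)
  qed
  have hull_le: "chord a b x \<le> 1" if ab: "consecutive T a b" and x: "x \<in> convex hull T" for a b x
  proof -
    have "convex hull T \<subseteq> chord a b -` {..1}"
    proof (rule hull_minimal)
      show "convex (chord a b -` {..1})"
        by (intro convex_linear_vimage linear_chord) auto
      show "T \<subseteq> chord a b -` {..1}"
      proof
        fix s assume s: "s \<in> T"
        have "\<not> 1 < chord a b s"
          using unit_beyond_chord[of a b s] ab s unit by (auto simp: consecutive_def)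
        then show "s \<in> chord a b -` {..1}" by simp
      qed
    qed
    then show ?thesis using x by auto
  qed
  have closed: "closed (convex hull T)"
    using fin by (simp add: finite_imp_compact_convex_hull compact_imp_closed)
  have "drawing (cyclic_edges vs) \<subseteq> frontier (convex hull T)"
  proof
    fix y assume "y \<in> drawing (cyclic_edges vs)"
    then obtain i where i: "i < length vs" "y \<in> closed_segment (vs ! i) (?n i)"
      by (auto simp: drawing_def cyclic_edges_def segment_convex_hull)
    note c = cons[OF i(1)]
    then have T: "vs ! i \<in> T" "?n i \<in> T" and d: "0 < det2 (vs ! i) (?n i)" by (auto simp: consecutive_def)
    obtain s where s: "y = (1 - s) *\<^sub>R (vs ! i) + s *\<^sub>R ?n i"
      using i(2) by (auto simp: in_segment)
    have y1: "chord (vs ! i) (?n i) y = 1"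
      using chord_ends d by (simp add: s linear_add[OF linear_chord] linear_scale[OF linear_chord])
    have "y \<in> convex hull T"
      using i(2) closed_segment_subset_convex_hull[OF hull_inc[OF T(1)] hull_inc[OF T(2)]] by (rule rev_subsetD)
    \<comment> \<open>Pushing an interior point \<open>y\<close> outwards from 0 would raise
      \<open>chord\<close> above 1 within the hull.\<close>
    moreover have "y \<notin> interior (convex hull T)"
    proof
      assume "y \<in> interior (convex hull T)"
      then obtain e where e: "0 < e" "y + e *\<^sub>R y \<in> convex hull T" using interior_extend by blast
      then show False
        using hull_le[OF c e(2)] y1
        by (simp add: linear_add[OF linear_chord] linear_scale[OF linear_chord])
    qed
    ultimately show "y \<in> frontier (convex hull T)" using closure_subset by (auto simp: frontier_def)
  qed
  moreover have "frontier (convex hull T) \<subseteq> drawing (cyclic_edges vs)"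
  proof
    fix y assume "y \<in> frontier (convex hull T)"
    then have yH: "y \<in> convex hull T" and yi: "y \<notin> interior (convex hull T)"
      using closed by (auto simp: frontier_def)
    have y0: "y \<noteq> 0" using yi int by auto
    then obtain i where i: "i < length vs" "0 \<le> det2 (vs ! i) (sgn y)" "0 \<le> det2 (sgn y) (?n i)"
      using vs(5)[of "sgn y"] by (auto simp: norm_sgn)
    let ?a = "vs ! i" and ?b = "?n i"
    have ge: "0 \<le> det2 ?a y" "0 \<le> det2 y ?b"
      using i y0 by (auto simp: sgn_div_norm zero_le_divide_iff zero_le_mult_iff)
    note c = cons[OF i(1)]
    then have T: "?a \<in> T" "?b \<in> T" and d: "0 < det2 ?a ?b" by (auto simp: consecutive_def)
    define l where "l = det2 y ?b / det2 ?a ?b"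
    define m where "m = det2 ?a y / det2 ?a ?b"
    have lm: "0 \<le> l" "0 \<le> m" "y = l *\<^sub>R ?a + m *\<^sub>R ?b"
      using ge d det2_cramer'[of ?a ?b y] by (auto simp: l_def m_def)
    have "l + m \<le> 1"
      using hull_le[OF c yH] by (simp add: chord_def l_def m_def add_divide_distrib)
    \<comment> \<open>Otherwise \<open>y\<close> is a point of the chord shrunk towards 0, thus
      interior.\<close>
    moreover have "\<not> l + m < 1"
    proof
      assume lt: "l + m < 1"
      have nz: "l + m \<noteq> 0"
      proof
        assume "l + m = 0"
        then have "l = 0" "m = 0" using lm by auto
        then show False using lm(3) y0 by simp
      qed
      let ?k = "l + m"
      have "(l / ?k) *\<^sub>R ?a + (m / ?k) *\<^sub>R ?b \<in> convex hull T"
        using T lm nz by (intro convexD[OF convex_convex_hull]) (auto intro: hull_inc simp: add_divide_distrib[symmetric])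
      then have "?k *\<^sub>R ((l / ?k) *\<^sub>R ?a + (m / ?k) *\<^sub>R ?b) \<in> interior (convex hull T)"
        using lm lt by (intro scale_in_interior int convex_convex_hull) auto
      then show False using nz lm(3) yi by (simp add: scaleR_add_right)
    qed
    ultimately have "l = 1 - m" "m \<le> 1" using lm by auto
    then have "y \<in> closed_segment ?a ?b"
      using lm by (auto simp: in_segment)
    then show "y \<in> drawing (cyclic_edges vs)"
      using i(1) by (auto simp: drawing_def cyclic_edges_def segment_convex_hull)
  qed
  ultimately show ?thesis using that vs len cons by blast
qed

text \<open>The hull of the projections contains 0, as a line separating it from 0 would leave all
  of \<open>S\<close> strictly on one side of 0. So it also contains the projections shrunk towards
  0, and scaling it by the largest norm \<open>M\<close> covers \<open>S\<close>.\<close>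

lemma interior_hull_sgn:
  fixes S :: "'a::euclidean_space set"
  assumes fin: "finite S" and 0: "0 \<notin> S" and int: "0 \<in> interior (convex hull S)"
  shows "0 \<in> interior (convex hull (sgn ` S))"
proof -
  let ?H = "convex hull (sgn ` S)"
  have H0: "0 \<in> ?H"
  proof (rule ccontr)
    assume "0 \<notin> ?H"
    moreover have "closed ?H"
      using fin by (simp add: finite_imp_compact_convex_hull compact_imp_closed)
    ultimately obtain a b where ab: "a \<noteq> 0" "0 < b" "\<And>x. x \<in> ?H \<Longrightarrow> b < a \<bullet> x"
      using separating_hyperplane_closed_0[of ?H] by auto
    have "convex hull S \<subseteq> {x. 0 < a \<bullet> x}"
    proof (rule hull_minimal)
      show "S \<subseteq> {x. 0 < a \<bullet> x}"
      proof
        fix s assume s: "s \<in> S"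
        have "0 < a \<bullet> sgn s" using ab(2) ab(3)[of "sgn s"] s hull_inc[of "sgn s" "sgn ` S" convex] by auto
        moreover have "s \<noteq> 0" using s 0 by auto
        ultimately show "s \<in> {x. 0 < a \<bullet> x}" by (simp add: sgn_div_norm zero_less_divide_iff zero_less_mult_iff)
      qed
    qed (rule convex_halfspace_gt)
    then show False using int interior_subset by fastforce
  qed
  define M where "M = Max (norm ` S)"
  have M: "norm s \<le> M" if "s \<in> S" for s using fin that by (simp add: M_def)
  have "S \<noteq> {}" using int by auto
  then have M0: "0 < M" using M 0 by (metis all_not_in_conv norm_le_zero_iff not_le order.trans)
  have sub: "convex hull S \<subseteq> (\<lambda>x. M *\<^sub>R x) ` ?H"
  proof (rule hull_minimal)
    show "S \<subseteq> (\<lambda>x. M *\<^sub>R x) ` ?H"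
    proof
      fix s assume s: "s \<in> S"
      have "(1 - norm s / M) *\<^sub>R 0 + (norm s / M) *\<^sub>R sgn s \<in> ?H"
        using M[OF s] M0 H0 s by (intro convexD_alt convex_convex_hull) (auto intro: hull_inc)
      moreover have "s = M *\<^sub>R ((norm s / M) *\<^sub>R sgn s)"
      proof -
        have "s \<noteq> 0" using s 0 by auto
        then show ?thesis using M0 by (simp add: sgn_div_norm)
      qed
      ultimately show "s \<in> (\<lambda>x. M *\<^sub>R x) ` ?H" by (metis add_0 image_eqI scaleR_zero_right)
    qed
  qed (simp add: convex_scaling)
  obtain r where r: "0 < r" "ball 0 r \<subseteq> convex hull S" using int by (auto simp: mem_interior)
  have "ball 0 (r / M) \<subseteq> ?H"
  proof
    fix x :: 'a assume "x \<in> ball 0 (r / M)"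
    then have "M *\<^sub>R x \<in> ball 0 r" using M0 by (simp add: field_simps)
    then obtain y where "y \<in> ?H" "M *\<^sub>R x = M *\<^sub>R y" using r sub by blast
    then show "x \<in> ?H" using M0 by simp
  qed
  then show ?thesis using r M0 by (auto simp: mem_interior intro!: exI[of _ "r / M"])
qed

text \<open>If two chords cross, each has an end of the other in its sector, and this end is no
  projected vertex of the chord's own region. Between two such ends the regions have a common
  vertex, whose projection falls into a sector that should be empty.\<close>

lemma consecutive_no_crossing:
  assumes G: "plane_straight_line_graph V E" and gen: "\<And>u v. u \<in> V \<Longrightarrow> v \<in> V \<Longrightarrow> u \<noteq> v \<Longrightarrow> det2 u v \<noteq> 0"
    and V0: "0 \<notin> V"
    and K: "region E K" and L: "region E L"
    and ab: "consecutive (sgn ` (V \<inter> K)) a b" and cd: "consecutive (sgn ` (V \<inter> L)) c d"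
    and ne: "{a, b} \<noteq> {c, d}"
  shows "open_segment a b \<inter> open_segment c d = {}"
proof (rule ccontr)
  assume "open_segment a b \<inter> open_segment c d \<noteq> {}"
  then obtain x where x: "x \<in> open_segment a b" "x \<in> open_segment c d" by auto
  have abT: "a \<in> sgn ` (V \<inter> K)" "b \<in> sgn ` (V \<inter> K)" "0 < det2 a b"
    and cdT: "c \<in> sgn ` (V \<inter> L)" "d \<in> sgn ` (V \<inter> L)" "0 < det2 c d"
    using ab cd by (auto simp: consecutive_def)
  have n: "norm a = 1" "norm b = 1" "norm c = 1" "norm d = 1"
    using abT cdT V0 by (auto simp: norm_sgn split: if_splits)
  have sectors: "(0 < det2 a c \<and> 0 < det2 c b) \<or> (0 < det2 a d \<and> 0 < det2 d b)"
    "(0 < det2 c a \<and> 0 < det2 a d) \<or> (0 < det2 c b \<and> 0 < det2 b d)"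
    using crossing_chord_sector[OF n abT(3) x ne] crossing_chord_sector[OF n(3,4,1,2) cdT(3) x(2,1)] ne
    by auto
  \<comment> \<open>The existence of a common vertex, carried over to projected vertices.\<close>
  have common: "\<exists>x\<in>V \<inter> K \<inter> L. 0 < det2 p (sgn x) \<and> 0 < det2 (sgn x) q"
    if K: "region E K" and L: "region E L" and p: "p \<in> sgn ` (V \<inter> K)" "p \<notin> sgn ` (V \<inter> L)"
      and q: "q \<in> sgn ` (V \<inter> L)" "q \<notin> sgn ` (V \<inter> K)" and pq: "0 < det2 p q" for K L p q
  proof -
    obtain u where u: "u \<in> V" "u \<in> K" "p = sgn u" using p by auto
    obtain v where v: "v \<in> V" "v \<in> L" "q = sgn v" using q by auto
    have nz: "u \<noteq> 0" "v \<noteq> 0" using u v V0 by auto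
    have "u \<notin> L" "v \<notin> K" using u v p q by auto
    moreover have "0 < det2 u v" using pq u v nz by simp
    ultimately obtain y where y: "y \<in> V" "y \<in> K" "y \<in> L" "0 < det2 u y" "0 < det2 y v"
      using regions_common_vertex[OF G gen K L u(1,2) _ v(1,2)] by blast
    have "y \<noteq> 0" using y V0 by auto
    then show ?thesis using y u v nz by (intro bexI[of _ y]) auto
  qed
  have noK: "\<not> (0 < det2 a s \<and> 0 < det2 s b)" if "s \<in> sgn ` (V \<inter> K)" for s
    using ab that by (auto simp: consecutive_def)
  have noL: "\<not> (0 < det2 c s \<and> 0 < det2 s d)" if "s \<in> sgn ` (V \<inter> L)" for s
    using cd that by (auto simp: consecutive_def)
  from sectors show False
  proof (elim disjE conjE)
    assume "0 < det2 a c" "0 < det2 c a"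
    then show False using det2_swap[of a c] by linarith
  next
    assume "0 < det2 d b" "0 < det2 b d"
    then show False using det2_swap[of d b] by linarith
  next
    \<comment> \<open>Here \<open>c\<close> comes only from \<open>L\<close> and \<open>b\<close>
      only from \<open>K\<close>. The common vertex between them projects into the sector from
      \<open>a\<close> to \<open>b\<close>.\<close>
    assume *: "0 < det2 a c" "0 < det2 c b" "0 < det2 c b" "0 < det2 b d"
    have "c \<notin> sgn ` (V \<inter> K)" "b \<notin> sgn ` (V \<inter> L)" using * noK noL by blast+
    then obtain y where y: "y \<in> V \<inter> K \<inter> L" "0 < det2 c (sgn y)" "0 < det2 (sgn y) b"
      using common[OF L K cdT(1) _ abT(2)] * by blast
    have "0 < det2 a (sgn y)"
      using sector_det2_left[of c b "sgn y" a] * y abT by simp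
    then show False using noK[of "sgn y"] y by blast
  next
    assume *: "0 < det2 a d" "0 < det2 d b" "0 < det2 c a" "0 < det2 a d"
    have "d \<notin> sgn ` (V \<inter> K)" "a \<notin> sgn ` (V \<inter> L)" using * noK noL by blast+
    then obtain y where y: "y \<in> V \<inter> K \<inter> L" "0 < det2 a (sgn y)" "0 < det2 (sgn y) d"
      using common[OF K L abT(1) _ cdT(2)] * by blast
    have "0 < det2 (sgn y) b"
      using sector_det2[of a d "sgn y" b] * y abT by simp
    then show False using noK[of "sgn y"] y by blast
  qed
qed

text \<open>Of three collinear points one lies between the other two, hence in the hull of the
  rest.\<close>

lemma convex_position_imp_general_position:
  assumes fin: "finite V" and conv: "convex_position V"
  shows "general_position V"
proof -
  have "\<not> collinear S" if S: "S \<subseteq> V" "card S = 3" for S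
  proof
    assume col: "collinear S"
    obtain a b c where abc: "S = {a, b, c}" "a \<noteq> b" "b \<noteq> c" "a \<noteq> c"
      using S(2) by (auto simp: card_3_iff)
    have notin: "x \<notin> convex hull T" if "x \<in> V" "T \<subseteq> V - {x}" for x T
      using conv that hull_mono[of T "V - {x}" convex] by (auto simp: convex_position_def)
    have "\<not> between (b, c) a" "\<not> between (c, a) b" "\<not> between (a, b) c"
      using notin[of a "{b, c}"] notin[of b "{c, a}"] notin[of c "{a, b}"] S(1) abc
      by (auto simp: between_mem_convex_hull)
    with col show False by (simp add: abc(1) collinear_between_cases)
  qed
  then show ?thesis using fin by (simp add: general_position_def)
qed

text \<open>The tangent of the circle at \<open>p\<close> has all other points strictly on one side:
  \<open>p \<bullet> x < 1\<close>.\<close>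

lemma convex_position_unit:
  assumes "\<And>v. v \<in> V \<Longrightarrow> norm v = 1"
  shows "convex_position V"
  unfolding convex_position_def
proof (intro ballI notI)
  fix p assume p: "p \<in> V" "p \<in> convex hull (V - {p})"
  have "convex hull (V - {p}) \<subseteq> {x. p \<bullet> x < 1}"
    by (rule hull_minimal) (use assms p inner_unit_less_1 in \<open>auto simp: convex_halfspace_lt\<close>)
  then show False using p assms by (auto simp: norm_eq_1)
qed

section \<open>Counting the regions around the origin\<close>

lemma cyclic_edges_Union: "\<Union>(cyclic_edges vs) = set vs"
proof
  show "\<Union>(cyclic_edges vs) \<subseteq> set vs"
    by (auto simp: cyclic_edges_def intro!: nth_mem mod_less_divisor)
  show "set vs \<subseteq> \<Union>(cyclic_edges vs)"
    by (auto simp: cyclic_edges_def in_set_conv_nth)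
qed

text \<open>Each region is sent to the cycle around its projected vertices. All these cycles
  together form a plane graph in convex position. The map is injective, because a cycle determines
  its vertices and these determine the region.\<close>

lemma card_regions_le:
  assumes G: "plane_straight_line_graph V E" and gen: "\<And>u v. u \<in> V \<Longrightarrow> v \<in> V \<Longrightarrow> u \<noteq> v \<Longrightarrow> det2 u v \<noteq> 0"
    and V0: "0 \<notin> V" and R: "\<And>K. K \<in> R \<Longrightarrow> region E K"
  shows "card R \<le> max_convex_polygons_convex_position (card V)"
proof -
  have finV: "finite V" using G by (simp add: plane_straight_line_graph_def general_position_def)
  let ?T = "\<lambda>K. sgn ` (V \<inter> K)"
  have unit: "norm v = 1" if "v \<in> sgn ` V" for v
    using that V0 by (auto simp: norm_sgn)
  \<comment> \<open>Two vertices on one ray from 0 would have \<open>det2\<close> equal to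
    0.\<close>
  have inj: "inj_on sgn V"
  proof (rule inj_onI, rule ccontr)
    fix u v assume uv: "u \<in> V" "v \<in> V" "sgn u = sgn v" "u \<noteq> v"
    have "u \<noteq> 0" "v \<noteq> 0" using uv V0 by auto
    then have "u = norm u *\<^sub>R sgn u" "v = norm v *\<^sub>R sgn v"
      by (simp_all add: sgn_div_norm)
    then have "det2 u v = 0"
      using uv(3) det2_linear_simps(3,4) by (metis det2_self mult_zero_right real_scaleR_def)
    then show False using gen uv by blast
  qed
  have "\<exists>vs. distinct vs \<and> 3 \<le> length vs \<and> set vs = ?T K \<and>
      (\<forall>i<length vs. consecutive (?T K) (vs ! i) (vs ! (Suc i mod length vs))) \<and>
      frontier (convex hull ?T K) = drawing (cyclic_edges vs)" if K: "K \<in> R" for K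
  proof -
    have "0 \<in> interior (convex hull (V \<inter> K))"
      using R[OF K] by (subst region_eq_hull[OF G R[OF K], symmetric]) (simp add: region_def)
    then have "0 \<in> interior (convex hull ?T K)"
      using finV V0 by (intro interior_hull_sgn) auto
    then obtain vs where "distinct vs" "3 \<le> length vs" "set vs = ?T K"
        "\<And>i. i < length vs \<Longrightarrow> consecutive (?T K) (vs ! i) (vs ! (Suc i mod length vs))"
        "frontier (convex hull ?T K) = drawing (cyclic_edges vs)"
      using unit finV by (elim unit_hull_cycle[rotated 2]) auto
    then show ?thesis by blast
  qed
  then have "\<forall>K\<in>R. \<exists>vs. distinct vs \<and> 3 \<le> length vs \<and> set vs = ?T K \<and>
      (\<forall>i<length vs. consecutive (?T K) (vs ! i) (vs ! (Suc i mod length vs))) \<and>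
      frontier (convex hull ?T K) = drawing (cyclic_edges vs)" by blast
  from bchoice[OF this] obtain vs where "\<forall>K\<in>R. distinct (vs K) \<and> 3 \<le> length (vs K) \<and> set (vs K) = ?T K \<and>
      (\<forall>i<length (vs K). consecutive (?T K) (vs K ! i) (vs K ! (Suc i mod length (vs K)))) \<and>
      frontier (convex hull ?T K) = drawing (cyclic_edges (vs K))" ..
  then have vs: "distinct (vs K)" "3 \<le> length (vs K)" "set (vs K) = ?T K"
      "\<And>i. i < length (vs K) \<Longrightarrow> consecutive (?T K) (vs K ! i) (vs K ! (Suc i mod length (vs K)))"
      "frontier (convex hull ?T K) = drawing (cyclic_edges (vs K))" if "K \<in> R" for K
    using that by auto
  define E' where "E' = (\<Union>K\<in>R. cyclic_edges (vs K))"
  have edge: "\<exists>K\<in>R. consecutive (?T K) a b \<or> consecutive (?T K) b a" if "{a, b} \<in> E'" for a b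
  proof -
    obtain K i where K: "K \<in> R" "i < length (vs K)" "{a, b} = {vs K ! i, vs K ! (Suc i mod length (vs K))}"
      using \<open>{a, b} \<in> E'\<close> by (auto simp: E'_def cyclic_edges_def)
    then show ?thesis using vs(4)[OF K(1,2)] by (auto simp: doubleton_eq_iff)
  qed
  have plane: "plane_straight_line_graph (sgn ` V) E'"
    unfolding plane_straight_line_graph_def
  proof (intro conjI ballI allI impI)
    show "general_position (sgn ` V)"
      using finV unit by (intro convex_position_imp_general_position convex_position_unit) auto
  next
    fix e assume "e \<in> E'"
    then obtain K i where K: "K \<in> R" "i < length (vs K)" "e = {vs K ! i, vs K ! (Suc i mod length (vs K))}"
      by (auto simp: E'_def cyclic_edges_def)
    then have c: "consecutive (?T K) (vs K ! i) (vs K ! (Suc i mod length (vs K)))" using vs(4) by blast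
    then show "e \<subseteq> sgn ` V" by (auto simp: K(3) consecutive_def)
    have "vs K ! i \<noteq> vs K ! (Suc i mod length (vs K))" using c by (auto simp: consecutive_def)
    then show "card e = 2" by (simp add: K(3))
  next
    fix a b c d assume e: "{a, b} \<in> E'" "{c, d} \<in> E'" "{a, b} \<noteq> {c, d}"
    obtain K where K: "K \<in> R" "consecutive (?T K) a b \<or> consecutive (?T K) b a" using edge[OF e(1)] by blast
    obtain L where L: "L \<in> R" "consecutive (?T L) c d \<or> consecutive (?T L) d c" using edge[OF e(2)] by blast
    \<comment> \<open>Each edge is consecutive in one of its two orientations, which leaves four
      cases.\<close>
    note * = consecutive_no_crossing[OF G gen V0 R[OF K(1)] R[OF L(1)]]
    show "open_segment a b \<inter> open_segment c d = {}"
      using K(2) L(2) *[of a b c d] *[of a b d c] *[of b a c d] *[of b a d c] e(3)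
      by (auto simp: open_segment_commute insert_commute)
  qed
  have poly: "is_convex_polygon E' (cyclic_edges (vs K))" if K: "K \<in> R" for K
    unfolding is_convex_polygon_def is_cycle_def
  proof (intro conjI exI)
    show "cyclic_edges (vs K) \<subseteq> E'" using K by (auto simp: E'_def)
    have "bounded (convex hull ?T K)"
      using finV by (simp add: finite_imp_compact_convex_hull compact_imp_bounded)
    then have "inside (drawing (cyclic_edges (vs K))) = interior (convex hull ?T K)"
      by (simp add: vs(5)[OF K, symmetric] inside_frontier_eq_interior)
    then show "convex (inside (drawing (cyclic_edges (vs K))))"
      by (simp add: convex_interior)
  qed (use vs K in auto)
  have "inj_on (\<lambda>K. cyclic_edges (vs K)) R"
  proof (rule inj_onI)
    fix K L assume KL: "K \<in> R" "L \<in> R" "cyclic_edges (vs K) = cyclic_edges (vs L)"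
    then have "?T K = ?T L" using cyclic_edges_Union vs(3) by metis
    then have "V \<inter> K = V \<inter> L" using inj by (simp add: inj_on_image_eq_iff)
    then show "K = L" using region_eq_hull[OF G] R KL by metis
  qed
  then have "card R = card ((\<lambda>K. cyclic_edges (vs K)) ` R)" by (simp add: card_image)
  also have "\<dots> \<le> num_convex_polygons E'"
    unfolding num_convex_polygons_def
  proof (rule card_mono)
    have "{F. is_convex_polygon E' F} \<subseteq> Pow (Pow (sgn ` V))"
      using plane by (auto simp: is_convex_polygon_def is_cycle_def plane_straight_line_graph_def)
    then show "finite {F. is_convex_polygon E' F}" using finV by (meson finite_Pow_iff finite_imageI finite_subset)
  qed (use poly in auto)
  also have "\<dots> \<le> max_convex_polygons_convex_position (card V)"
    unfolding max_convex_polygons_convex_position_def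
  proof (rule Max_ge[OF finite_num_convex_polygons_convex_position])
    have "convex_position (sgn ` V)" "card (sgn ` V) = card V"
      using unit inj by (auto intro: convex_position_unit simp: card_image)
    then show "num_convex_polygons E' \<in> {num_convex_polygons E | V' E.
        plane_straight_line_graph V' E \<and> convex_position V' \<and> card V' = card V}"
      using plane by blast
  qed
  finally show ?thesis .
qed

section \<open>Piercing the convex polygons\<close>

text \<open>The clockwise quarter turn.\<close>

definition rot :: "real^2 \<Rightarrow> real^2" where
  "rot w = vector [w $ 2, - w $ 1]"

lemma rot_nth [simp]: "rot w $ 1 = w $ 2" "rot w $ 2 = - w $ 1"
  by (simp_all add: rot_def)

lemma rot_eq_0_iff [simp]: "rot w = 0 \<longleftrightarrow> w = 0"
  by (auto simp: vec_eq_iff forall_2)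

lemma inner_rot_rot: "rot v \<bullet> rot w = v \<bullet> w"
  by (simp add: inner_vec_def sum_2)

lemma inner_rot_self [simp]: "rot w \<bullet> w = 0" "w \<bullet> rot w = 0"
  by (simp_all add: inner_vec_def sum_2)

lemma det2_inner_rot: "det2 x w = rot w \<bullet> x"
  by (simp add: det2_def inner_vec_def sum_2 algebra_simps)

lemma orthogonal_imp_multiple_rot:
  assumes "g \<noteq> 0" "g \<bullet> w = 0"
  obtains c where "w = c *\<^sub>R rot g"
proof -
  have 0: "g $ 1 * w $ 1 + g $ 2 * w $ 2 = 0"
    using assms(2) by (simp add: inner_vec_def sum_2)
  consider "g $ 1 \<noteq> 0" | "g $ 2 \<noteq> 0"
    using assms(1) by (auto simp: vec_eq_iff forall_2)
  then show ?thesis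
  proof cases
    case 1
    then have "w = (- w $ 2 / g $ 1) *\<^sub>R rot g"
      using 0 by (simp add: vec_eq_iff forall_2 field_simps)
    then show ?thesis by (rule that)
  next
    case 2
    then have "w = (w $ 1 / g $ 2) *\<^sub>R rot g"
      using 0 by (simp add: vec_eq_iff forall_2 field_simps)
    then show ?thesis by (rule that)
  qed
qed

lemma collinear_hyperplane:
  fixes g :: "real^2"
  assumes "g \<noteq> 0" "\<And>x. x \<in> S \<Longrightarrow> g \<bullet> x = k"
  shows "collinear S"
proof -
  have "\<exists>c. x - y = c *\<^sub>R rot g" if "x \<in> S" "y \<in> S" for x y
    using orthogonal_imp_multiple_rot[OF assms(1), of "x - y"] assms(2) that
    by (metis inner_diff_right diff_self)
  then show ?thesis unfolding collinear_def by blast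
qed

text \<open>Hyperplanes are null sets and a nonempty open set is not. A pair \<open>(a, c)\<close>
  stands for the hyperplane \<open>a \<bullet> x = c\<close>.\<close>

lemma open_avoids_hyperplanes:
  fixes U :: "'a::euclidean_space set"
  assumes "finite H" "\<And>a c. (a, c) \<in> H \<Longrightarrow> a \<noteq> 0" "open U" "U \<noteq> {}"
  obtains x where "x \<in> U" "\<And>a c. (a, c) \<in> H \<Longrightarrow> a \<bullet> x \<noteq> c"
proof -
  have "negligible (\<Union>(a, c)\<in>H. {x. a \<bullet> x = c})"
    using assms(1,2) by (auto intro!: negligible_Union negligible_hyperplane)
  moreover have "\<not> negligible U" using assms(3,4) by (rule open_not_negligible)
  ultimately have "\<not> U \<subseteq> (\<Union>(a, c)\<in>H. {x. a \<bullet> x = c})" using negligible_subset by blast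
  then show ?thesis using that by auto
qed

section \<open>Moving the piercing point to the origin\<close>

lemma drawing_translation: "drawing ((`) ((+) c) ` F) = (+) c ` drawing F"
  unfolding drawing_def by (simp add: convex_hull_translation image_UN)

lemma plane_straight_line_graph_translation:
  assumes G: "plane_straight_line_graph V E"
  shows "plane_straight_line_graph ((+) c ` V) ((`) ((+) c) ` E)"
  unfolding plane_straight_line_graph_def general_position_def
proof (intro conjI ballI allI impI)
  show "finite ((+) c ` V)"
    using G by (simp add: plane_straight_line_graph_def general_position_def)
next
  fix S assume S: "S \<subseteq> (+) c ` V" "card S = 3"
  then obtain S' where S': "S' \<subseteq> V" "S = (+) c ` S'" by (auto simp: subset_image_iff)
  have "card S' = 3" using S S' by (simp add: card_image)
  then have "\<not> collinear S'"
    using G S' by (auto simp: plane_straight_line_graph_def general_position_def)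
  then show "\<not> collinear S" by (auto simp: S' collinear_def)
next
  fix e assume "e \<in> (`) ((+) c) ` E"
  then show "e \<subseteq> (+) c ` V" "card e = 2"
    using G by (auto simp: plane_straight_line_graph_def card_image)
next
  let ?E = "(`) ((+) c) ` E"
  have shift: "{a - c, b - c} \<in> E" if "{a, b} \<in> ?E" for a b
  proof -
    obtain d where d: "d \<in> E" "{a, b} = (+) c ` d" using \<open>{a, b} \<in> ?E\<close> by auto
    have "{a - c, b - c} = (\<lambda>x. x - c) ` {a, b}" by simp
    also have "\<dots> = d" unfolding d(2) by (simp add: image_image)
    finally show ?thesis using d(1) by simp
  qed
  fix a b a' b' assume e: "{a, b} \<in> ?E" "{a', b'} \<in> ?E" "{a, b} \<noteq> {a', b'}"
  have "{a - c, b - c} \<noteq> {a' - c, b' - c}" using e(3) by (auto simp: doubleton_eq_iff)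
  then have disj: "open_segment (a - c) (b - c) \<inter> open_segment (a' - c) (b' - c) = {}"
    using G shift[OF e(1)] shift[OF e(2)] unfolding plane_straight_line_graph_def by blast
  have tr: "open_segment x y = (+) c ` open_segment (x - c) (y - c)" for x y
    using open_segment_translation[of c "x - c" "y - c"] by simp
  have "inj ((+) c)" by simp
  show "open_segment a b \<inter> open_segment a' b' = {}"
    unfolding tr[of a b] tr[of a' b'] image_Int[OF \<open>inj ((+) c)\<close>, symmetric] disj by simp
qed

text \<open>An open convex set is the interior of its closure, so the closed polygon keeps both the
  inside and the boundary curve.\<close>

lemma convex_polygon_closure:
  assumes G: "plane_straight_line_graph V E" and F: "is_convex_polygon E F"
  defines "K \<equiv> closure (inside (drawing F))"
  shows "compact K" "convex K" "interior K = inside (drawing F)" "frontier K = drawing F" "F \<subseteq> E"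
    "drawing F \<subseteq> K"
proof -
  note I = convex_polygon_inside[OF G F]
  show "compact K" "convex K" using I by (auto simp: K_def compact_closure convex_closure)
  show int: "interior K = inside (drawing F)"
    using I by (simp add: K_def convex_interior_closure interior_open)
  show "frontier K = drawing F"
    using int I(5) I(1) by (simp add: K_def frontier_def interior_open)
  then show "drawing F \<subseteq> K"
    using frontier_subset_closed[of K] by (simp add: K_def)
  show "F \<subseteq> E" using F by (simp add: is_convex_polygon_def is_cycle_def)
qed

lemma drawing_subset_convex:
  assumes G: "plane_straight_line_graph V E" and F: "F \<subseteq> E" and C: "convex C" "V \<subseteq> C"
  shows "drawing F \<subseteq> C"
  unfolding drawing_def
proof (rule UN_least)
  fix e assume "e \<in> F"
  then have "e \<subseteq> C" using G F C(2) by (auto simp: plane_straight_line_graph_def)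
  then show "convex hull e \<subseteq> C" using C(1) by (rule hull_minimal)
qed

text \<open>The midpoint of \<open>e\<close> is no vertex, so it lies inside an edge of
  \<open>F\<close>. In a plane graph that edge is \<open>e\<close>.\<close>

lemma edge_in_drawing:
  assumes G: "plane_straight_line_graph V E" and F: "F \<subseteq> E" and e: "e \<in> E" "convex hull e \<subseteq> drawing F"
  shows "e \<in> F"
proof -
  obtain a b where ab: "e = {a, b}" "a \<noteq> b"
    using G e by (auto simp: plane_straight_line_graph_def card_2_iff)
  have m: "midpoint a b \<in> open_segment a b" using ab by (simp add: midpoint_in_open_segment)
  then have "midpoint a b \<in> convex hull e"
    by (simp add: ab segment_convex_hull[symmetric] open_segment_def)
  then obtain f where f: "f \<in> F" "midpoint a b \<in> convex hull f"
    using e by (auto simp: drawing_def)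
  then have "f \<subseteq> V" "card f = 2" using G F by (auto simp: plane_straight_line_graph_def)
  then obtain c d where cd: "f = {c, d}" "c \<in> V" "d \<in> V"
    by (auto simp: card_2_iff)
  have "midpoint a b \<notin> V"
    using plane_vertex_notin_open_segment[OF G, of a b "midpoint a b"] e(1) m ab(1) by blast
  then have "midpoint a b \<noteq> c" "midpoint a b \<noteq> d" using cd by auto
  then have "midpoint a b \<in> open_segment c d"
    using f cd by (simp add: open_segment_def segment_convex_hull)
  then have "{a, b} = {c, d}"
    using plane_open_segments_eq[OF G, of a b c d "midpoint a b"] e(1) f(1) F ab(1) cd(1) m by blast
  then show ?thesis using f ab cd by simp
qed

lemma drawing_inj:
  assumes "plane_straight_line_graph V E" "F \<subseteq> E" "F' \<subseteq> E" "drawing F = drawing F'"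
  shows "F = F'"
proof -
  have sub: "e \<in> F'" if "e \<in> F" "F \<subseteq> E" "F' \<subseteq> E" "drawing F = drawing F'" for e F F'
  proof (rule edge_in_drawing[OF assms(1)])
    show "convex hull e \<subseteq> drawing F'" unfolding that(4)[symmetric] unfolding drawing_def using that(1) by (rule UN_upper)
  qed (use that in auto)
  show ?thesis
    using sub[OF _ assms(2,3,4)] sub[OF _ assms(3,2) assms(4)[symmetric]] by blast
qed

text \<open>After translating \<open>p\<close> to the origin, the closures of the insides are
  regions; they are distinct for distinct polygons because the frontier gives back the edges.
  Assumption \<open>gen\<close> says that \<open>p\<close> lies on no line through two
  vertices.\<close>

lemma card_polygons_around_point_le:
  assumes G: "plane_straight_line_graph V E" and V2: "2 \<le> card V"
    and gen: "\<And>u v. u \<in> V \<Longrightarrow> v \<in> V \<Longrightarrow> u \<noteq> v \<Longrightarrow> det2 (u - p) (v - p) \<noteq> 0"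
  shows "card {F. is_convex_polygon E F \<and> p \<in> inside (drawing F)} \<le> max_convex_polygons_convex_position (card V)"
proof -
  let ?P = "{F. is_convex_polygon E F \<and> p \<in> inside (drawing F)}"
  let ?t = "(+) (- p)"
  let ?r = "\<lambda>F. ?t ` closure (inside (drawing F))"
  \<comment> \<open>If \<open>p\<close> were a vertex, \<open>gen\<close> would fail for
    \<open>p\<close> and a second vertex, which exists by \<open>2 \<le> card V\<close>.\<close>
  have "p \<notin> V"
  proof
    assume p: "p \<in> V"
    have "\<not> V \<subseteq> {p}" using V2 card_mono[of "{p}" V] by auto
    then obtain v where "v \<in> V" "v \<noteq> p" by auto
    then show False using gen[OF p, of v] by simp
  qed
  then have p: "0 \<notin> ?t ` V" by auto
  have gen': "det2 u v \<noteq> 0" if "u \<in> ?t ` V" "v \<in> ?t ` V" "u \<noteq> v" for u v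
    using that gen by (auto simp: minus_add_distrib)
  have "card ?P = card (?r ` ?P)"
  proof (rule card_image[symmetric], rule inj_onI)
    fix F F' assume F: "F \<in> ?P" "F' \<in> ?P" "?r F = ?r F'"
    then have eq: "closure (inside (drawing F)) = closure (inside (drawing F'))"
      by (simp add: inj_image_eq_iff)
    have fr: "frontier (closure (inside (drawing F))) = drawing F"
      "frontier (closure (inside (drawing F'))) = drawing F'"
      using convex_polygon_closure(4)[OF G] F by auto
    have "drawing F = drawing F'"
      by (rule trans[OF trans[OF fr(1)[symmetric] arg_cong[OF eq, of frontier]] fr(2)])
    then show "F = F'"
      using drawing_inj[OF G] convex_polygon_closure(5)[OF G] F by blast
  qed
  also have "\<dots> \<le> max_convex_polygons_convex_position (card (?t ` V))"
  proof (rule card_regions_le[OF plane_straight_line_graph_translation[OF G] gen' p])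
    fix K assume "K \<in> ?r ` ?P"
    then obtain F where F: "is_convex_polygon E F" "p \<in> inside (drawing F)" "K = ?r F" by auto
    note C = convex_polygon_closure[OF G F(1)]
    have "0 \<in> interior K"
      unfolding F(3) interior_translation C(3) using F(2) by (auto simp: image_iff)
    moreover have "frontier K = drawing ((`) ?t ` F)"
      unfolding F(3) frontier_translation C(4) drawing_translation ..
    moreover have "(`) ?t ` F \<subseteq> (`) ?t ` E" using C(5) by (rule image_mono)
    moreover have "compact K" "convex K"
      unfolding F(3) by (rule compact_translation[OF C(1)], rule convex_translation[OF C(2)])
    ultimately show "region ((`) ?t ` E) K" unfolding region_def by blast
  qed
  finally show ?thesis by (simp add: card_image)
qed

section \<open>Points just beside a middle vertex\<close>

lemma convex_combination_interior:
  fixes K :: "(real^2) set"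
  assumes K: "convex K" "interior K \<noteq> {}" and abc: "a \<in> K" "b \<in> K" "c \<in> K" "\<not> collinear {a, b, c}"
    and pos: "0 < u" "0 < v" "0 < w" "u + v + w = 1"
  shows "u *\<^sub>R a + v *\<^sub>R b + w *\<^sub>R c \<in> interior K" (is "?y \<in> _")
proof (rule ccontr)
  assume no: "?y \<notin> interior K"
  have "convex hull {a, b, c} \<subseteq> K" using K abc by (intro hull_minimal) auto
  moreover have "?y \<in> convex hull {a, b, c}"
    unfolding convex_hull_3 using pos by (intro CollectI exI[of _ u] exI[of _ v] exI[of _ w]) auto
  ultimately have y: "?y \<in> K" by blast
  have "?y \<notin> rel_interior K" using no rel_interior_nonempty_interior[OF K(2)] by simp
  \<comment> \<open>The supporting functional attains its minimum over \<open>K\<close> at a strict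
    convex combination of \<open>a\<close>, \<open>b\<close>, \<open>c\<close>, hence at all three,
    which would then be collinear.\<close>
  then obtain g where g: "g \<noteq> 0" "\<And>x. x \<in> K \<Longrightarrow> g \<bullet> ?y \<le> g \<bullet> x"
    using supporting_hyperplane_rel_boundary[OF K(1) y] by metis
  define \<delta> where "\<delta> x = g \<bullet> x - g \<bullet> ?y" for x
  have "u * \<delta> a + v * \<delta> b + w * \<delta> c = g \<bullet> ?y - (u + v + w) * (g \<bullet> ?y)"
    by (simp add: \<delta>_def inner_add algebra_simps)
  then have sum: "u * \<delta> a + v * \<delta> b + w * \<delta> c = 0" using pos by simp
  have nn: "0 \<le> u * \<delta> a" "0 \<le> v * \<delta> b" "0 \<le> w * \<delta> c"
    using g abc pos by (auto simp: \<delta>_def)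
  have "u * \<delta> a = 0" "v * \<delta> b = 0" "w * \<delta> c = 0" using sum nn by linarith+
  then have "\<delta> a = 0" "\<delta> b = 0" "\<delta> c = 0" using pos by auto
  then have "collinear {a, b, c}"
    using g(1) by (intro collinear_hyperplane[of g _ "g \<bullet> ?y"]) (auto simp: \<delta>_def)
  then show False using abc by blast
qed

text \<open>The line through \<open>b\<close> in direction \<open>rot h\<close> meets the segment
  from \<open>a\<close> to \<open>c\<close> at a point other than \<open>b\<close>. The points
  strictly between are interior; \<open>\<sigma>\<close> records on which side of \<open>b\<close>
  they lie.\<close>

lemma middle_vertex_pierces:
  fixes h :: "real^2"
  assumes K: "convex K" "interior K \<noteq> {}" and abc: "a \<in> K" "b \<in> K" "c \<in> K" "\<not> collinear {a, b, c}"
    and h: "h \<bullet> a < h \<bullet> b" "h \<bullet> b < h \<bullet> c"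
  obtains \<sigma> :: real where "\<sigma> \<in> {1, -1}" "\<forall>\<^sub>F \<epsilon> in at_right 0. b + (\<sigma> * \<epsilon>) *\<^sub>R rot h \<in> interior K"
proof -
  have h0: "h \<noteq> 0" using h by auto
  \<comment> \<open>Chosen such that the point \<open>m\<close> of the segment has the same value of
    \<open>h\<close> as \<open>b\<close>.\<close>
  define s where "s = (h \<bullet> b - h \<bullet> a) / (h \<bullet> c - h \<bullet> a)"
  have s: "0 < s" "s < 1" using h by (auto simp: s_def)
  define m where "m = (1 - s) *\<^sub>R a + s *\<^sub>R c"
  have "h \<bullet> m = h \<bullet> a + s * (h \<bullet> c - h \<bullet> a)" by (simp add: m_def inner_add algebra_simps)
  also have "\<dots> = h \<bullet> b" using h by (simp add: s_def)
  finally have "h \<bullet> (m - b) = 0" by (simp add: inner_diff)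
  then obtain t where t: "m - b = t *\<^sub>R rot h" using orthogonal_imp_multiple_rot[OF h0] by blast
  have "t \<noteq> 0"
  proof
    assume "t = 0"
    then have "b \<in> closed_segment a c" using t s by (auto simp: m_def in_segment intro!: exI[of _ s])
    then have "collinear {a, b, c}"
      by (simp add: collinear_between_cases between_mem_segment closed_segment_commute)
    then show False using abc by blast
  qed
  have "b + (sgn t * \<epsilon>) *\<^sub>R rot h \<in> interior K" if e: "0 < \<epsilon>" "\<epsilon> < \<bar>t\<bar>" for \<epsilon>
  proof -
    define u where "u = \<epsilon> / \<bar>t\<bar>"
    have u: "0 < u" "u < 1" using e by (auto simp: u_def)
    have "sgn t * \<epsilon> = u * t" using \<open>t \<noteq> 0\<close> by (simp add: u_def sgn_if field_simps)
    then have "b + (sgn t * \<epsilon>) *\<^sub>R rot h = b + u *\<^sub>R (m - b)" by (simp add: t)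
    also have "\<dots> = (u * (1 - s)) *\<^sub>R a + (1 - u) *\<^sub>R b + (u * s) *\<^sub>R c"
      by (simp add: m_def algebra_simps)
    also have "\<dots> \<in> interior K"
      using s u by (intro convex_combination_interior K abc) (auto simp: algebra_simps)
    finally show ?thesis .
  qed
  then have "\<forall>\<^sub>F \<epsilon> in at_right 0. b + (sgn t * \<epsilon>) *\<^sub>R rot h \<in> interior K"
    using \<open>t \<noteq> 0\<close> unfolding eventually_at_right_field by (intro exI[of _ "\<bar>t\<bar>"]) auto
  moreover have "sgn t \<in> {1, -1}" using \<open>t \<noteq> 0\<close> by (auto simp: sgn_if)
  ultimately show ?thesis using that by blast
qed

text \<open>The filter speaks of points close enough to \<open>b\<close> in direction
  \<open>w\<close>, without fixing a distance that would depend on the polygon.\<close>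

definition polygons_at :: "(real^2) set set \<Rightarrow> real^2 \<Rightarrow> real^2 \<Rightarrow> (real^2) set set set" where
  "polygons_at E b w =
    {F. is_convex_polygon E F \<and> (\<forall>\<^sub>F \<epsilon> in at_right 0. b + \<epsilon> *\<^sub>R w \<in> inside (drawing F))}"

lemma finite_convex_polygons:
  assumes "plane_straight_line_graph V E"
  shows "finite {F. is_convex_polygon E F}"
proof (rule finite_subset)
  show "{F. is_convex_polygon E F} \<subseteq> Pow (Pow V)"
    using assms by (auto simp: is_convex_polygon_def is_cycle_def plane_straight_line_graph_def)
  show "finite (Pow (Pow V))"
    using assms by (simp add: plane_straight_line_graph_def general_position_def)
qed

lemma finite_polygons_at:
  assumes "plane_straight_line_graph V E"
  shows "finite (polygons_at E b w)"
  by (rule finite_subset[OF _ finite_convex_polygons[OF assms]]) (auto simp: polygons_at_def)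

text \<open>As there are finitely many polygons, one small distance works for all, so their insides
  have a common point. The intersection is open, which leaves room to move to a point on no line
  through two vertices.\<close>

lemma card_polygons_at_le:
  assumes G: "plane_straight_line_graph V E" and V2: "2 \<le> card V"
  shows "card (polygons_at E b w) \<le> max_convex_polygons_convex_position (card V)"
proof -
  have finV: "finite V" using G by (simp add: plane_straight_line_graph_def general_position_def)
  let ?P = "polygons_at E b w"
  have finP: "finite ?P" by (rule finite_polygons_at[OF G])
  have "\<forall>\<^sub>F \<epsilon> in at_right 0. \<forall>F\<in>?P. b + \<epsilon> *\<^sub>R w \<in> inside (drawing F)"
    using finP by (intro eventually_ball_finite) (auto simp: polygons_at_def)
  then obtain \<epsilon> :: real where "\<forall>F\<in>?P. b + \<epsilon> *\<^sub>R w \<in> inside (drawing F)"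
    using eventually_happens'[OF trivial_limit_at_right_real] by blast
  then have ne: "(\<Inter>F\<in>?P. inside (drawing F)) \<noteq> {}" by blast
  have op: "open (\<Inter>F\<in>?P. inside (drawing F))"
    using finP convex_polygon_inside(1)[OF G] by (auto simp: polygons_at_def)
  \<comment> \<open>The lines through two vertices, as the solutions \<open>p\<close> of
    \<open>det2 p (v - u) = det2 u v\<close>.\<close>
  define H where "H = (\<lambda>(u, v). (rot (v - u), det2 u v)) ` (V \<times> V - Id)"
  have H: "a \<noteq> 0" if "(a, c) \<in> H" for a c
    using finV that by (auto simp: H_def)
  have finH: "finite H" using finV by (auto simp: H_def)
  obtain p where p: "p \<in> (\<Inter>F\<in>?P. inside (drawing F))" "\<And>a c. (a, c) \<in> H \<Longrightarrow> a \<bullet> p \<noteq> c"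
  proof (rule open_avoids_hyperplanes[OF finH H op ne])
    fix x assume "x \<in> (\<Inter>F\<in>?P. inside (drawing F))" "\<And>a c. (a, c) \<in> H \<Longrightarrow> a \<bullet> x \<noteq> c"
    then show thesis by (rule that)
  qed
  have gen: "det2 (u - p) (v - p) \<noteq> 0" if "u \<in> V" "v \<in> V" "u \<noteq> v" for u v
  proof -
    have "(rot (v - u), det2 u v) \<in> H" using that by (force simp: H_def)
    then have "det2 p (v - u) \<noteq> det2 u v" using p(2) by (simp add: det2_inner_rot)
    then show ?thesis by (simp add: det2_def algebra_simps)
  qed
  have "card ?P \<le> card {F. is_convex_polygon E F \<and> p \<in> inside (drawing F)}"
    using p(1) finite_subset[OF _ finite_convex_polygons[OF G]]
    by (intro card_mono) (auto simp: polygons_at_def)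
  also have "\<dots> \<le> max_convex_polygons_convex_position (card V)"
    using card_polygons_around_point_le[OF G V2 gen] .
  finally show ?thesis .
qed

text \<open>Of any three vertices of the polygon, the middle one in direction \<open>h\<close> will
  do; injectivity makes their order strict.\<close>

lemma convex_polygon_at_middle_vertex:
  assumes G: "plane_straight_line_graph V E" and F: "is_convex_polygon E F"
    and h: "inj_on ((\<bullet>) h) V"
  obtains a b c \<sigma> where "a \<in> V" "b \<in> V" "c \<in> V" "h \<bullet> a < h \<bullet> b" "h \<bullet> b < h \<bullet> c"
    "\<sigma> \<in> {1, -1}" "F \<in> polygons_at E b (\<sigma> *\<^sub>R rot h)"
proof -
  note C = convex_polygon_closure[OF G F]
  let ?K = "closure (inside (drawing F))"
  obtain vs where vs: "distinct vs" "3 \<le> length vs" "F = cyclic_edges vs"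
    using F by (auto simp: is_convex_polygon_def is_cycle_def)
  have sV: "set vs \<subseteq> V"
    using cyclic_edges_Union[of vs] vs(3) C(5) G by (auto simp: plane_straight_line_graph_def)
  have sD: "set vs \<subseteq> drawing F"
    using cyclic_edges_Union[of vs] vs(3) by (auto simp: drawing_def intro: hull_inc)
  have "\<exists>a b c. {a, b, c} \<subseteq> set vs \<and> h \<bullet> a < h \<bullet> b \<and> h \<bullet> b < h \<bullet> c"
  proof -
    obtain x y z where xyz: "{x, y, z} \<subseteq> set vs" "x \<noteq> y" "y \<noteq> z" "x \<noteq> z"
    proof (rule that)
      have len: "0 < length vs" "1 < length vs" "2 < length vs" using vs(2) by linarith+
      then show "{vs ! 0, vs ! 1, vs ! 2} \<subseteq> set vs" by auto
      show "vs ! 0 \<noteq> vs ! 1" "vs ! 1 \<noteq> vs ! 2" "vs ! 0 \<noteq> vs ! 2"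
        using vs(1) len by (simp_all add: nth_eq_iff_index_eq)
    qed
    have V: "x \<in> V" "y \<in> V" "z \<in> V" using xyz(1) sV by auto
    have "h \<bullet> x \<noteq> h \<bullet> y" "h \<bullet> y \<noteq> h \<bullet> z" "h \<bullet> x \<noteq> h \<bullet> z"
      using inj_onD[OF h _ V(1,2)] inj_onD[OF h _ V(2,3)] inj_onD[OF h _ V(1,3)] xyz(2-4) by blast+
    then consider "h \<bullet> x < h \<bullet> y" "h \<bullet> y < h \<bullet> z" | "h \<bullet> x < h \<bullet> z" "h \<bullet> z < h \<bullet> y"
      | "h \<bullet> y < h \<bullet> x" "h \<bullet> x < h \<bullet> z" | "h \<bullet> y < h \<bullet> z" "h \<bullet> z < h \<bullet> x"
      | "h \<bullet> z < h \<bullet> x" "h \<bullet> x < h \<bullet> y" | "h \<bullet> z < h \<bullet> y" "h \<bullet> y < h \<bullet> x"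
      by linarith
    then show ?thesis
      using xyz(1) by cases blast+
  qed
  then obtain a b c where abc: "a \<in> set vs" "b \<in> set vs" "c \<in> set vs" "h \<bullet> a < h \<bullet> b" "h \<bullet> b < h \<bullet> c"
    by auto
  have "\<not> collinear {a, b, c}"
  proof -
    have "a \<noteq> b" "b \<noteq> c" "a \<noteq> c" using abc(4,5) by auto
    then have "card {a, b, c} = 3" by simp
    moreover have "{a, b, c} \<subseteq> V" using abc sV by auto
    ultimately show ?thesis using G unfolding plane_straight_line_graph_def general_position_def by blast
  qed
  moreover have "a \<in> ?K" "b \<in> ?K" "c \<in> ?K" using abc sD C(6) by auto
  moreover have "interior ?K \<noteq> {}" unfolding C(3) by (rule convex_polygon_inside(4)[OF G F])
  ultimately obtain \<sigma> :: real where \<sigma>: "\<sigma> \<in> {1, -1}"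
      "\<forall>\<^sub>F \<epsilon> in at_right 0. b + (\<sigma> * \<epsilon>) *\<^sub>R rot h \<in> interior ?K"
    using middle_vertex_pierces[OF C(2), of a b c h] abc by blast
  then have "F \<in> polygons_at E b (\<sigma> *\<^sub>R rot h)"
    using F by (simp add: polygons_at_def C(3) mult.commute)
  then show ?thesis using that abc sV \<sigma>(1) by blast
qed

section \<open>The bound for a single graph\<close>

lemma num_convex_polygons_le_convex_position:
  assumes G: "plane_straight_line_graph V E" and V3: "3 \<le> card V"
  shows "num_convex_polygons E \<le> (2 * card V - 5) * max_convex_polygons_convex_position (card V)"
proof -
  have finV: "finite V" using G by (simp add: plane_straight_line_graph_def general_position_def)
  have V0: "V \<noteq> {}" using V3 by auto
  \<comment> \<open>A vector \<open>h\<close> off these hyperplanes is orthogonal to no difference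
    of two vertices, so it orders \<open>V\<close> strictly.\<close>
  define H where "H = (\<lambda>(u, v). (u - v, 0::real)) ` (V \<times> V - Id)"
  have H: "a \<noteq> 0" if "(a, c) \<in> H" for a c
    using that by (auto simp: H_def)
  have finH: "finite H" using finV by (auto simp: H_def)
  obtain h :: "real^2" where h: "\<And>a c. (a, c) \<in> H \<Longrightarrow> a \<bullet> h \<noteq> c"
  proof (rule open_avoids_hyperplanes[OF finH H open_UNIV UNIV_not_empty])
    fix x assume "\<And>a c. (a, c) \<in> H \<Longrightarrow> a \<bullet> x \<noteq> c"
    then show thesis by (rule that)
  qed
  have inj: "inj_on ((\<bullet>) h) V"
  proof (rule inj_onI, rule ccontr)
    fix u v assume uv: "u \<in> V" "v \<in> V" "h \<bullet> u = h \<bullet> v" "u \<noteq> v"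
    then have "(u - v, 0) \<in> H" by (force simp: H_def)
    then have "(u - v) \<bullet> h \<noteq> 0" by (rule h)
    then show False using uv(3) by (simp add: inner_commute[of _ h] inner_diff_right)
  qed
  have minimizer: "\<exists>v\<in>V. \<forall>w\<in>V. g v \<le> g w" for g :: "real^2 \<Rightarrow> real"
    using arg_min_if_finite[OF finV V0, of g] by (meson linorder_not_less)
  obtain l where l: "l \<in> V" "\<And>v. v \<in> V \<Longrightarrow> h \<bullet> l \<le> h \<bullet> v"
    using minimizer[of "(\<bullet>) h"] by blast
  obtain r where r: "r \<in> V" "\<And>v. v \<in> V \<Longrightarrow> h \<bullet> v \<le> h \<bullet> r"
    using minimizer[of "\<lambda>v. - (h \<bullet> v)"] by auto
  have lr: "l \<noteq> r"
  proof
    assume "l = r"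
    then have eq: "h \<bullet> v = h \<bullet> l" if "v \<in> V" for v
      using l(2)[OF that] r(2)[OF that] by simp
    have "v = l" if "v \<in> V" for v
      by (rule inj_onD[OF inj eq[OF that] that l(1)])
    then have "V \<subseteq> {l}" by blast
    then have "card V \<le> 1" using card_mono[of "{l}" V] by simp
    then show False using V3 by simp
  qed
  have "h \<bullet> l \<noteq> h \<bullet> r" using inj_onD[OF inj _ l(1) r(1)] lr by blast
  then have hlr: "h \<bullet> l < h \<bullet> r" using l(2)[OF r(1)] by simp
  \<comment> \<open>A normal of the line through \<open>l\<close> and \<open>r\<close>. Its product
    with \<open>rot h\<close> is positive, so moving along \<open>rot h\<close> changes the signed
    distance from this line.\<close>
  define k where "k = rot (r - l)"
  have k0: "k \<noteq> 0" using lr by (simp add: k_def)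
  have kr: "k \<bullet> r = k \<bullet> l"
    using inner_rot_self(1)[of "r - l"] by (simp add: k_def inner_diff_right)
  have kh: "0 < k \<bullet> rot h"
    unfolding k_def inner_rot_rot using hlr by (simp add: inner_diff inner_commute)
  \<comment> \<open>Up to the factor \<open>norm k\<close>, the distance from the line through
    \<open>l\<close> and \<open>r\<close>; \<open>b\<^sub>0\<close> is a farthest vertex.\<close>
  define f where "f x = \<bar>k \<bullet> x - k \<bullet> l\<bar>" for x
  obtain b\<^sub>0 where b0: "b\<^sub>0 \<in> V" "\<And>v. v \<in> V \<Longrightarrow> f v \<le> f b\<^sub>0"
    using minimizer[of "\<lambda>v. - f v"] by auto
  have f0: "0 < f b\<^sub>0"
  proof (rule ccontr)
    assume "\<not> 0 < f b\<^sub>0"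
    then have "k \<bullet> v = k \<bullet> l" if "v \<in> V" for v using b0(2)[OF that] by (simp add: f_def)
    then have "collinear V" by (rule collinear_hyperplane[OF k0])
    moreover obtain S where S: "S \<subseteq> V" "card S = 3" using obtain_subset_with_card_n[OF V3] by metis
    ultimately have "collinear S" using collinear_subset by blast
    then show False
      using G S by (simp add: plane_straight_line_graph_def general_position_def)
  qed
  \<comment> \<open>The side of that line on which \<open>b\<^sub>0\<close> lies, so that a step
    along \<open>\<sigma>\<^sub>0 *\<^sub>R rot h\<close> leads farther away from it.\<close>
  define \<sigma>\<^sub>0 where "\<sigma>\<^sub>0 = sgn (k \<bullet> b\<^sub>0 - k \<bullet> l)"
  have \<sigma>0: "\<sigma>\<^sub>0 \<in> {1, -1}" using f0 by (auto simp: \<sigma>\<^sub>0_def f_def sgn_if)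
  have empty: "polygons_at E b\<^sub>0 (\<sigma>\<^sub>0 *\<^sub>R rot h) = {}"
  proof (rule ccontr)
    assume "\<not> ?thesis"
    then obtain F where F: "is_convex_polygon E F"
      "\<forall>\<^sub>F \<epsilon> in at_right 0. b\<^sub>0 + \<epsilon> *\<^sub>R \<sigma>\<^sub>0 *\<^sub>R rot h \<in> inside (drawing F)"
      by (auto simp: polygons_at_def)
    have "\<forall>\<^sub>F \<epsilon> in at_right 0. (0::real) < \<epsilon>" by (rule eventually_at_right_less)
    with F(2) have "\<forall>\<^sub>F \<epsilon> in at_right 0. 0 < \<epsilon> \<and> b\<^sub>0 + \<epsilon> *\<^sub>R \<sigma>\<^sub>0 *\<^sub>R rot h \<in> inside (drawing F)"
      by (rule eventually_conj[rotated])
    then obtain \<epsilon> where e: "0 < \<epsilon>" "b\<^sub>0 + \<epsilon> *\<^sub>R \<sigma>\<^sub>0 *\<^sub>R rot h \<in> inside (drawing F)"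
      using eventually_happens'[OF trivial_limit_at_right_real] by blast
    \<comment> \<open>The strip around the line with \<open>b\<^sub>0\<close> on its border. It
      contains \<open>V\<close>, hence all edges and all that they enclose, but not the points just
      outside \<open>b\<^sub>0\<close>.\<close>
    let ?C = "{x. k \<bullet> x \<le> k \<bullet> l + f b\<^sub>0} \<inter> {x. k \<bullet> x \<ge> k \<bullet> l - f b\<^sub>0}"
    have conv: "convex ?C" by (intro convex_Int convex_halfspace_le convex_halfspace_ge)
    have "V \<subseteq> ?C"
    proof
      fix v assume "v \<in> V"
      then have "f v \<le> f b\<^sub>0" by (rule b0(2))
      then show "v \<in> ?C" by (simp add: f_def abs_le_iff)
    qed
    then have "drawing F \<subseteq> ?C"
      by (rule drawing_subset_convex[OF G convex_polygon_closure(5)[OF G F(1)] conv])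
    then have "- ?C \<subseteq> outside (drawing F)" by (rule outside_subset_convex[OF conv])
    then have "inside (drawing F) \<subseteq> ?C" using inside_Int_outside[of "drawing F"] by blast
    with e(2) have "b\<^sub>0 + \<epsilon> *\<^sub>R \<sigma>\<^sub>0 *\<^sub>R rot h \<in> ?C" by (rule rev_subsetD)
    then have "f (b\<^sub>0 + \<epsilon> *\<^sub>R \<sigma>\<^sub>0 *\<^sub>R rot h) \<le> f b\<^sub>0"
      unfolding f_def[of "_ + _"] by (simp add: abs_le_iff)
    moreover have "f (b\<^sub>0 + \<epsilon> *\<^sub>R \<sigma>\<^sub>0 *\<^sub>R rot h) = f b\<^sub>0 + \<epsilon> * (k \<bullet> rot h)"
    proof -
      have "0 < \<epsilon> * (k \<bullet> rot h)" using e kh by simp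
      then show ?thesis using f0 by (auto simp: f_def \<sigma>\<^sub>0_def inner_add sgn_if)
    qed
    moreover have "0 < \<epsilon> * (k \<bullet> rot h)" using e kh by simp
    ultimately show False by linarith
  qed
  \<comment> \<open>The \<open>2 (card V - 2)\<close> pairs of a vertex other than \<open>l\<close>,
    \<open>r\<close> and a side, without the one that has no polygon: \<open>2 * card V - 5\<close>
    pairs remain.\<close>
  define M where "M = (V - {l, r}) \<times> {1, -1::real} - {(b\<^sub>0, \<sigma>\<^sub>0)}"
  have finM: "finite M" using finV by (simp add: M_def)
  have "b\<^sub>0 \<noteq> l" "b\<^sub>0 \<noteq> r" using f0 kr by (auto simp: f_def)
  then have "(b\<^sub>0, \<sigma>\<^sub>0) \<in> (V - {l, r}) \<times> {1, -1}" using b0 \<sigma>0 by simp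
  moreover have "card (V - {l, r}) = card V - 2"
    using l r lr finV by (simp add: card_Diff_subset)
  ultimately have cardM: "card M = 2 * card V - 5"
    using finV by (simp add: M_def card_cartesian_product)
  have "{F. is_convex_polygon E F} \<subseteq> (\<Union>(b, \<sigma>)\<in>M. polygons_at E b (\<sigma> *\<^sub>R rot h))"
  proof
    fix F assume "F \<in> {F. is_convex_polygon E F}"
    then obtain a b c \<sigma> where abc: "a \<in> V" "b \<in> V" "c \<in> V" "h \<bullet> a < h \<bullet> b" "h \<bullet> b < h \<bullet> c"
      "\<sigma> \<in> {1, -1}" "F \<in> polygons_at E b (\<sigma> *\<^sub>R rot h)"
      using convex_polygon_at_middle_vertex[OF G _ inj] by blast
    have "b \<noteq> l" "b \<noteq> r" using abc l(2)[of a] r(2)[of c] by auto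
    moreover have "(b, \<sigma>) \<noteq> (b\<^sub>0, \<sigma>\<^sub>0)" using abc(7) empty by auto
    ultimately have "(b, \<sigma>) \<in> M" using abc by (auto simp: M_def)
    then show "F \<in> (\<Union>(b, \<sigma>)\<in>M. polygons_at E b (\<sigma> *\<^sub>R rot h))" using abc(7) by blast
  qed
  then have "num_convex_polygons E \<le> card (\<Union>(b, \<sigma>)\<in>M. polygons_at E b (\<sigma> *\<^sub>R rot h))"
    unfolding num_convex_polygons_def using finM
    by (intro card_mono finite_UN_I) (auto intro: finite_polygons_at[OF G])
  also have "\<dots> \<le> (\<Sum>(b, \<sigma>)\<in>M. card (polygons_at E b (\<sigma> *\<^sub>R rot h)))"
    using card_UN_le[OF finM, of "\<lambda>(b, \<sigma>). polygons_at E b (\<sigma> *\<^sub>R rot h)"]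
    by (simp add: case_prod_unfold)
  also have "\<dots> \<le> of_nat (card M) * max_convex_polygons_convex_position (card V)"
    using card_polygons_at_le[OF G] V3 by (intro sum_bounded_above) auto
  finally show ?thesis by (simp add: cardM)
qed

theorem theorem3:
  fixes n :: nat
  assumes "n \<ge> 3"
  shows "max_convex_polygons n \<le> (2 * n - 5) * max_convex_polygons_convex_position n"
  unfolding max_convex_polygons_def
proof (rule Max.boundedI[OF finite_num_convex_polygons])
  show "{num_convex_polygons E |V E. plane_straight_line_graph V E \<and> card V = n} \<noteq> {}"
    using convex_position_graph_exists[of n] by blast
qed (use num_convex_polygons_le_convex_position assms in blast)

end
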